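(* Let $\mathbb{C}$ be a small strict monoidal category. Then the covariant isotropy group $\mathcal{Z}(\mathbb{C})$ of $\mathbb{C}$ in the category $\mathsf{StrMonCat}$ is isomorphic to the Picard group of $\mathbb{C}$, i.e. the group of invertible elements of the monoid $(\mathrm{Ob}(\mathbb{C}),\otimes,I)$ of objects of $\mathbb{C}$.
   Context: $\mathsf{StrMonCat}$ is the category of small strict monoidal categories and strict monoidal functors. For a category $\mathcal{E}$ and object $X$, the covariant isotropy group $\mathcal{Z}(X)$ is the group of natural automorphisms of the projection functor $\pi:X/\mathcal{E}\to\mathcal{E}$ (sending an arrow $X\to Y$ to $Y$); equivalently, families of automorphisms $\alpha_m:Y\to Y$, one for each $m:X\to Y$, such that $\alpha_{nm}\circ n=n\circ\alpha_m$ for every $n:Y\to Z$. *)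

theory Defs
  imports "HOL-Algebra.Group" "HOL-Library.FuncSet" "HOL-Library.Equipollence"
begin

record ('o, 'm) cat =
  Obj :: "'o set"
  Arr :: "'m set"
  Dom :: "'m \<Rightarrow> 'o"
  Cod :: "'m \<Rightarrow> 'o"
  Ide :: "'o \<Rightarrow> 'm"
  Comp :: "'m \<Rightarrow> 'm \<Rightarrow> 'm"  \<comment> \<open>\<open>Comp C g f\<close> is \<open>g\<close> after \<open>f\<close>\<close>

locale category =
  fixes C :: "('o, 'm, 'z) cat_scheme"
  assumes Dom_in: "f \<in> Arr C \<Longrightarrow> Dom C f \<in> Obj C"
    and Cod_in: "f \<in> Arr C \<Longrightarrow> Cod C f \<in> Obj C"
    and Ide_in: "x \<in> Obj C \<Longrightarrow> Ide C x \<in> Arr C"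
    and Dom_Ide: "x \<in> Obj C \<Longrightarrow> Dom C (Ide C x) = x"
    and Cod_Ide: "x \<in> Obj C \<Longrightarrow> Cod C (Ide C x) = x"
    and Comp_in: "\<lbrakk>f \<in> Arr C; g \<in> Arr C; Cod C f = Dom C g\<rbrakk> \<Longrightarrow> Comp C g f \<in> Arr C"
    and Dom_Comp: "\<lbrakk>f \<in> Arr C; g \<in> Arr C; Cod C f = Dom C g\<rbrakk> \<Longrightarrow> Dom C (Comp C g f) = Dom C f"
    and Cod_Comp: "\<lbrakk>f \<in> Arr C; g \<in> Arr C; Cod C f = Dom C g\<rbrakk> \<Longrightarrow> Cod C (Comp C g f) = Cod C g"
    and Comp_assoc: "\<lbrakk>f \<in> Arr C; g \<in> Arr C; h \<in> Arr C; Cod C f = Dom C g; Cod C g = Dom C h\<rbrakk>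
      \<Longrightarrow> Comp C (Comp C h g) f = Comp C h (Comp C g f)"
    and Comp_Ide_right: "f \<in> Arr C \<Longrightarrow> Comp C f (Ide C (Dom C f)) = f"
    and Comp_Ide_left: "f \<in> Arr C \<Longrightarrow> Comp C (Ide C (Cod C f)) f = f"

definition automorphisms :: "('o, 'm, 'z) cat_scheme \<Rightarrow> 'o \<Rightarrow> 'm set" where
  "automorphisms E Y = {f \<in> Arr E. Dom E f = Y \<and> Cod E f = Y \<and>
     (\<exists>g \<in> Arr E. Dom E g = Y \<and> Cod E g = Y \<and> Comp E g f = Ide E Y \<and> Comp E f g = Ide E Y)}"

text \<open>
  The objects of the coslice \<open>X/E\<close> are the arrows out of \<open>X\<close>, and an arrow of \<open>X/E\<close> from \<open>m\<close>
  to \<open>m'\<close> is an arrow \<open>n\<close> of \<open>E\<close> with \<open>m' = n m\<close>.  A natural automorphism of the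
  projection \<open>X/E \<rightarrow> E\<close> is therefore a family as below.  Families are undefined outside the
  coslice objects, so that equality of families is equality of their components.
\<close>

definition coslice_objects :: "('o, 'm, 'z) cat_scheme \<Rightarrow> 'o \<Rightarrow> 'm set" where
  "coslice_objects E X = {m \<in> Arr E. Dom E m = X}"

definition isotropy_group :: "('o, 'm, 'z) cat_scheme \<Rightarrow> 'o \<Rightarrow> ('m \<Rightarrow> 'm) monoid" where
  "isotropy_group E X =
    \<lparr>carrier = {\<alpha> \<in> (\<Pi>\<^sub>E m \<in> coslice_objects E X. automorphisms E (Cod E m)).
        \<forall>m \<in> coslice_objects E X. \<forall>n \<in> Arr E. Dom E n = Cod E m \<longrightarrow>
          Comp E (\<alpha> (Comp E n m)) n = Comp E n (\<alpha> m)},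
     monoid.mult = (\<lambda>\<alpha> \<beta>. \<lambda>m \<in> coslice_objects E X. Comp E (\<alpha> m) (\<beta> m)),
     one = (\<lambda>m \<in> coslice_objects E X. Ide E (Cod E m))\<rparr>"

record ('o, 'm) moncat = "('o, 'm) cat" +
  TensO :: "'o \<Rightarrow> 'o \<Rightarrow> 'o"
  TensA :: "'m \<Rightarrow> 'm \<Rightarrow> 'm"
  UnitO :: "'o"

locale strict_monoidal_category = category C
  for C :: "('o, 'm, 'z) moncat_scheme" +
  assumes UnitO_in: "UnitO C \<in> Obj C"
    and TensO_in: "\<lbrakk>x \<in> Obj C; y \<in> Obj C\<rbrakk> \<Longrightarrow> TensO C x y \<in> Obj C"
    and TensA_in: "\<lbrakk>f \<in> Arr C; g \<in> Arr C\<rbrakk> \<Longrightarrow> TensA C f g \<in> Arr C"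
    and Dom_TensA: "\<lbrakk>f \<in> Arr C; g \<in> Arr C\<rbrakk> \<Longrightarrow> Dom C (TensA C f g) = TensO C (Dom C f) (Dom C g)"
    and Cod_TensA: "\<lbrakk>f \<in> Arr C; g \<in> Arr C\<rbrakk> \<Longrightarrow> Cod C (TensA C f g) = TensO C (Cod C f) (Cod C g)"
    and TensA_Ide: "\<lbrakk>x \<in> Obj C; y \<in> Obj C\<rbrakk> \<Longrightarrow> TensA C (Ide C x) (Ide C y) = Ide C (TensO C x y)"
    and TensA_Comp: "\<lbrakk>f \<in> Arr C; g \<in> Arr C; f' \<in> Arr C; g' \<in> Arr C;
        Cod C f = Dom C g; Cod C f' = Dom C g'\<rbrakk>
      \<Longrightarrow> TensA C (Comp C g f) (Comp C g' f') = Comp C (TensA C g g') (TensA C f f')"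
    and TensO_assoc: "\<lbrakk>x \<in> Obj C; y \<in> Obj C; z \<in> Obj C\<rbrakk>
      \<Longrightarrow> TensO C (TensO C x y) z = TensO C x (TensO C y z)"
    and TensO_UnitO_left: "x \<in> Obj C \<Longrightarrow> TensO C (UnitO C) x = x"
    and TensO_UnitO_right: "x \<in> Obj C \<Longrightarrow> TensO C x (UnitO C) = x"
    and TensA_assoc: "\<lbrakk>f \<in> Arr C; g \<in> Arr C; h \<in> Arr C\<rbrakk>
      \<Longrightarrow> TensA C (TensA C f g) h = TensA C f (TensA C g h)"
    and TensA_UnitO_left: "f \<in> Arr C \<Longrightarrow> TensA C (Ide C (UnitO C)) f = f"
    and TensA_UnitO_right: "f \<in> Arr C \<Longrightarrow> TensA C f (Ide C (UnitO C)) = f"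

text \<open>
  A strict monoidal functor carries its source and target; its two maps are undefined outside the
  carriers of the source, so that equality is equality of functors.
\<close>

record ('o, 'm) smfunctor =
  Src :: "('o, 'm) moncat"
  Tgt :: "('o, 'm) moncat"
  OMap :: "'o \<Rightarrow> 'o"
  AMap :: "'m \<Rightarrow> 'm"

locale strict_monoidal_functor =
  fixes F :: "('o, 'm) smfunctor"
  assumes Src: "strict_monoidal_category (Src F)"
    and Tgt: "strict_monoidal_category (Tgt F)"
    and OMap: "OMap F \<in> Obj (Src F) \<rightarrow>\<^sub>E Obj (Tgt F)"
    and AMap: "AMap F \<in> Arr (Src F) \<rightarrow>\<^sub>E Arr (Tgt F)"
    and Dom_AMap: "f \<in> Arr (Src F) \<Longrightarrow> Dom (Tgt F) (AMap F f) = OMap F (Dom (Src F) f)"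
    and Cod_AMap: "f \<in> Arr (Src F) \<Longrightarrow> Cod (Tgt F) (AMap F f) = OMap F (Cod (Src F) f)"
    and AMap_Ide: "x \<in> Obj (Src F) \<Longrightarrow> AMap F (Ide (Src F) x) = Ide (Tgt F) (OMap F x)"
    and AMap_Comp: "\<lbrakk>f \<in> Arr (Src F); g \<in> Arr (Src F); Cod (Src F) f = Dom (Src F) g\<rbrakk>
      \<Longrightarrow> AMap F (Comp (Src F) g f) = Comp (Tgt F) (AMap F g) (AMap F f)"
    and OMap_UnitO: "OMap F (UnitO (Src F)) = UnitO (Tgt F)"
    and OMap_TensO: "\<lbrakk>x \<in> Obj (Src F); y \<in> Obj (Src F)\<rbrakk>
      \<Longrightarrow> OMap F (TensO (Src F) x y) = TensO (Tgt F) (OMap F x) (OMap F y)"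
    and AMap_TensA: "\<lbrakk>f \<in> Arr (Src F); g \<in> Arr (Src F)\<rbrakk>
      \<Longrightarrow> AMap F (TensA (Src F) f g) = TensA (Tgt F) (AMap F f) (AMap F g)"

text \<open>
  Smallness is relative to a universe \<open>U\<close> of subsets of a type \<open>'u\<close>.  Only two
  properties are required, so this notion covers both the family of all subsets of an infinite
  type and, for an inaccessible cardinal \<open>\<kappa>\<close> and a type of that cardinality, the family of
  all subsets of cardinality less than \<open>\<kappa>\<close>.
\<close>

definition universe :: "'u set set \<Rightarrow> bool" where
  "universe U \<longleftrightarrow> (\<exists>A \<in> U. infinite A) \<and> (\<forall>A \<in> U. \<forall>B. B \<lesssim> A \<longrightarrow> B \<in> U)"

definition small_strict_monoidal_category :: "'u set set \<Rightarrow> ('u, 'u) moncat \<Rightarrow> bool" where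
  "small_strict_monoidal_category U C \<longleftrightarrow>
     strict_monoidal_category C \<and> Obj C \<in> U \<and> Arr C \<in> U"

definition StrMonCat :: "'u set set \<Rightarrow> (('u, 'u) moncat, ('u, 'u) smfunctor) cat" where
  "StrMonCat U =
    \<lparr>Obj = {C. small_strict_monoidal_category U C},
     Arr = {F. strict_monoidal_functor F \<and>
       small_strict_monoidal_category U (Src F) \<and> small_strict_monoidal_category U (Tgt F)},
     Dom = Src,
     Cod = Tgt,
     Ide = (\<lambda>C. \<lparr>Src = C, Tgt = C, OMap = (\<lambda>x \<in> Obj C. x), AMap = (\<lambda>f \<in> Arr C. f)\<rparr>),
     Comp = (\<lambda>G F. \<lparr>Src = Src F, Tgt = Tgt G,
       OMap = compose (Obj (Src F)) (OMap G) (OMap F),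
       AMap = compose (Arr (Src F)) (AMap G) (AMap F)\<rparr>)\<rparr>"

definition object_monoid :: "('o, 'm, 'z) moncat_scheme \<Rightarrow> 'o monoid" where
  "object_monoid C = \<lparr>carrier = Obj C, monoid.mult = TensO C, one = UnitO C\<rparr>"

definition Picard_group :: "('o, 'm, 'z) moncat_scheme \<Rightarrow> 'o monoid" where
  "Picard_group C = units_of (object_monoid C)"

lemma universe_UNIV: "infinite (UNIV :: 'u set) \<Longrightarrow> universe (UNIV :: 'u set set)"
  unfolding universe_def by blast

lemma monoid_object_monoid:
  assumes "strict_monoidal_category C"
  shows "monoid (object_monoid C)"
proof -
  interpret strict_monoidal_category C by fact
  show ?thesis
    by unfold_locales
      (auto simp: object_monoid_def UnitO_in TensO_in TensO_assoc TensO_UnitO_left TensO_UnitO_right)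
qed

lemma group_Picard_group:
  "strict_monoidal_category C \<Longrightarrow> group (Picard_group C)"
  unfolding Picard_group_def by (intro monoid.units_group monoid_object_monoid)

lemma strict_monoidal_functor_comp:
  assumes "strict_monoidal_functor F" "strict_monoidal_functor G" "Tgt F = Src G"
  shows "strict_monoidal_functor \<lparr>Src = Src F, Tgt = Tgt G,
       OMap = compose (Obj (Src F)) (OMap G) (OMap F),
       AMap = compose (Arr (Src F)) (AMap G) (AMap F)\<rparr>"
proof -
  interpret F: strict_monoidal_functor F by fact
  interpret G: strict_monoidal_functor G by fact
  interpret S: strict_monoidal_category "Src F" by (rule F.Src)
  have o: "OMap F x \<in> Obj (Src G)" if "x \<in> Obj (Src F)" for x
    using F.OMap that assms(3) by auto
  have a: "AMap F x \<in> Arr (Src G)" if "x \<in> Arr (Src F)" for x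
    using F.AMap that assms(3) by auto
  show ?thesis
    by (rule strict_monoidal_functor.intro;
        insert F.Dom_AMap F.Cod_AMap F.AMap_Ide F.AMap_Comp F.OMap_UnitO F.OMap_TensO F.AMap_TensA
          G.OMap G.AMap)
      (auto simp: F.Src G.Tgt compose_def o a assms(3) S.Dom_in S.Cod_in S.Ide_in S.Comp_in
        S.UnitO_in S.TensO_in S.TensA_in G.Dom_AMap G.Cod_AMap G.AMap_Ide G.AMap_Comp
        G.OMap_UnitO G.OMap_TensO G.AMap_TensA)
qed

lemma strict_monoidal_functor_id:
  assumes "strict_monoidal_category C"
  shows "strict_monoidal_functor
    \<lparr>Src = C, Tgt = C, OMap = (\<lambda>x \<in> Obj C. x), AMap = (\<lambda>f \<in> Arr C. f)\<rparr>"
proof -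
  interpret strict_monoidal_category C by fact
  show ?thesis
    by (rule strict_monoidal_functor.intro)
      (auto simp: assms Dom_in Cod_in Ide_in Comp_in UnitO_in TensO_in TensA_in)
qed

lemma category_StrMonCat: "category (StrMonCat U)"
proof -
  have *: "OMap F \<in> Obj (Src F) \<rightarrow>\<^sub>E Obj (Tgt F)" "AMap F \<in> Arr (Src F) \<rightarrow>\<^sub>E Arr (Tgt F)"
    if "strict_monoidal_functor F" for F :: "('u, 'u) smfunctor"
    using that strict_monoidal_functor.OMap strict_monoidal_functor.AMap by blast+
  show ?thesis
  proof (unfold_locales, goal_cases)
    case (9 f g h)
    then show ?case
      using *[of f] *[of g] *[of h] by (auto simp: StrMonCat_def compose_def fun_eq_iff)
  next
    case (10 f)
    then show ?case
      using *[of f]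
      by (intro smfunctor.equality)
        (auto simp: StrMonCat_def compose_def fun_eq_iff restrict_def PiE_def extensional_def)
  next
    case (11 f)
    then show ?case
      using *[of f]
      by (intro smfunctor.equality)
        (auto simp: StrMonCat_def compose_def fun_eq_iff restrict_def PiE_def extensional_def Pi_iff)
  qed (auto simp: StrMonCat_def small_strict_monoidal_category_def
        intro: strict_monoidal_functor_id strict_monoidal_functor_comp)
qed

lemma group_isotropy_group:
  assumes "category E" "X \<in> Obj E"
  shows "group (isotropy_group E X)"
proof -
  interpret category E by fact
  let ?S = "coslice_objects E X"
  let ?G = "isotropy_group E X"
  have S: "m \<in> Arr E" "Dom E m = X" "Cod E m \<in> Obj E" if "m \<in> ?S" for m
    using that by (auto simp: coslice_objects_def Cod_in)
  have Sn: "Comp E n m \<in> ?S" if "m \<in> ?S" "n \<in> Arr E" "Dom E n = Cod E m" for m n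
    using that by (auto simp: coslice_objects_def Comp_in Dom_Comp)
  have aut_comp: "Comp E f g \<in> automorphisms E Y"
    if fg: "f \<in> automorphisms E Y" "g \<in> automorphisms E Y" for f g Y
  proof -
    obtain f' g' where f: "f \<in> Arr E" "Dom E f = Y" "Cod E f = Y" "f' \<in> Arr E"
        "Dom E f' = Y" "Cod E f' = Y" "Comp E f' f = Ide E Y" "Comp E f f' = Ide E Y"
      and g: "g \<in> Arr E" "Dom E g = Y" "Cod E g = Y" "g' \<in> Arr E"
        "Dom E g' = Y" "Cod E g' = Y" "Comp E g' g = Ide E Y" "Comp E g g' = Ide E Y"
      using fg unfolding automorphisms_def by blast
    have "Comp E f' (Comp E f g) = g"
      using f g Comp_assoc[of g f f'] Comp_Ide_left[of g] by simp
    then have 1: "Comp E (Comp E g' f') (Comp E f g) = Ide E Y"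
      using f g by (simp add: Comp_assoc Comp_in Dom_Comp Cod_Comp)
    have "Comp E g (Comp E g' f') = f'"
      using f g Comp_assoc[of f' g' g] Comp_Ide_left[of f'] by simp
    then have "Comp E (Comp E f g) (Comp E g' f') = Ide E Y"
      using f g by (simp add: Comp_assoc Comp_in Dom_Comp Cod_Comp)
    then show ?thesis
      using f g 1 unfolding automorphisms_def
      by (auto intro!: bexI[of _ "Comp E g' f'"] simp: Comp_in Dom_Comp Cod_Comp)
  qed
  have aut: "f \<in> Arr E" "Dom E f = Y" "Cod E f = Y" if "f \<in> automorphisms E Y" for f Y
    using that by (auto simp: automorphisms_def)
  have aut_id: "Ide E Y \<in> automorphisms E Y" if "Y \<in> Obj E" for Y
    using that Comp_Ide_left[of "Ide E Y"]
    by (auto simp: automorphisms_def Ide_in Dom_Ide Cod_Ide intro!: bexI[of _ "Ide E Y"])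
  have \<alpha>: "\<alpha> m \<in> automorphisms E (Cod E m)" "\<alpha> m \<in> Arr E" "Dom E (\<alpha> m) = Cod E m"
      "Cod E (\<alpha> m) = Cod E m"
    if "\<alpha> \<in> carrier ?G" "m \<in> ?S" for \<alpha> m
  proof -
    show *: "\<alpha> m \<in> automorphisms E (Cod E m)"
      using that by (auto simp: isotropy_group_def)
    show "\<alpha> m \<in> Arr E" "Dom E (\<alpha> m) = Cod E m" "Cod E (\<alpha> m) = Cod E m"
      using aut[OF *] by auto
  qed
  have nat: "Comp E (\<alpha> (Comp E n m)) n = Comp E n (\<alpha> m)"
    if "\<alpha> \<in> carrier ?G" "m \<in> ?S" "n \<in> Arr E" "Dom E n = Cod E m" for \<alpha> m n
    using that by (auto simp: isotropy_group_def)
  have ext: "\<alpha> = \<beta>" if "\<alpha> \<in> extensional ?S" "\<beta> \<in> extensional ?S" "\<And>m. m \<in> ?S \<Longrightarrow> \<alpha> m = \<beta> m"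
    for \<alpha> \<beta> :: "'b \<Rightarrow> 'b"
    using that by (rule extensionalityI)
  have cext: "\<alpha> \<in> extensional ?S" if "\<alpha> \<in> carrier ?G" for \<alpha>
    using that by (auto simp: isotropy_group_def PiE_def)
  have mult: "\<alpha> \<otimes>\<^bsub>?G\<^esub> \<beta> = (\<lambda>m \<in> ?S. Comp E (\<alpha> m) (\<beta> m))" for \<alpha> \<beta>
    by (simp add: isotropy_group_def)
  have one: "\<one>\<^bsub>?G\<^esub> = (\<lambda>m \<in> ?S. Ide E (Cod E m))"
    by (simp add: isotropy_group_def)
  have closed: "\<alpha> \<otimes>\<^bsub>?G\<^esub> \<beta> \<in> carrier ?G" if "\<alpha> \<in> carrier ?G" "\<beta> \<in> carrier ?G" for \<alpha> \<beta>
  proof -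
    have "Comp E (Comp E (\<alpha> (Comp E n m)) (\<beta> (Comp E n m))) n = Comp E n (Comp E (\<alpha> m) (\<beta> m))"
      if mn: "m \<in> ?S" "n \<in> Arr E" "Dom E n = Cod E m" for m n
    proof -
      note [simp] = \<alpha>[OF \<open>\<alpha> \<in> carrier ?G\<close> mn(1)] \<alpha>[OF \<open>\<beta> \<in> carrier ?G\<close> mn(1)]
        \<alpha>[OF \<open>\<alpha> \<in> carrier ?G\<close> Sn[OF mn]] \<alpha>[OF \<open>\<beta> \<in> carrier ?G\<close> Sn[OF mn]]
      have [simp]: "Cod E (Comp E n m) = Cod E n"
        using mn S by (simp add: Cod_Comp)
      have "Comp E (Comp E (\<alpha> (Comp E n m)) (\<beta> (Comp E n m))) n
          = Comp E (\<alpha> (Comp E n m)) (Comp E n (\<beta> m))"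
        using mn by (simp add: Comp_assoc nat[OF \<open>\<beta> \<in> carrier ?G\<close> mn])
      also have "\<dots> = Comp E (Comp E (\<alpha> (Comp E n m)) n) (\<beta> m)"
        using mn by (simp add: Comp_assoc)
      also have "\<dots> = Comp E n (Comp E (\<alpha> m) (\<beta> m))"
        using mn by (simp add: nat[OF \<open>\<alpha> \<in> carrier ?G\<close> mn] Comp_assoc)
      finally show ?thesis .
    qed
    then show ?thesis
      using that \<alpha> by (auto simp: mult) (auto simp: isotropy_group_def Sn intro!: aut_comp)
  qed
  show ?thesis
  proof (rule groupI)
    show one_in: "\<one>\<^bsub>?G\<^esub> \<in> carrier ?G"
      unfolding one
      by (auto simp: isotropy_group_def Sn S aut_id Cod_Comp Comp_Ide_left)
        (metis Comp_Ide_left Comp_Ide_right)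
    show "\<alpha> \<otimes>\<^bsub>?G\<^esub> \<beta> \<otimes>\<^bsub>?G\<^esub> \<gamma> = \<alpha> \<otimes>\<^bsub>?G\<^esub> (\<beta> \<otimes>\<^bsub>?G\<^esub> \<gamma>)"
      if "\<alpha> \<in> carrier ?G" "\<beta> \<in> carrier ?G" "\<gamma> \<in> carrier ?G" for \<alpha> \<beta> \<gamma>
      using \<alpha>[OF that(1)] \<alpha>[OF that(2)] \<alpha>[OF that(3)]
      by (intro ext) (auto simp: mult Comp_assoc)
    show "\<one>\<^bsub>?G\<^esub> \<otimes>\<^bsub>?G\<^esub> \<alpha> = \<alpha>" if "\<alpha> \<in> carrier ?G" for \<alpha>
      by (rule ext) (use that \<alpha>[OF that] Comp_Ide_left in \<open>force simp: mult one cext\<close>)+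
    show "\<exists>\<beta> \<in> carrier ?G. \<beta> \<otimes>\<^bsub>?G\<^esub> \<alpha> = \<one>\<^bsub>?G\<^esub>" if A: "\<alpha> \<in> carrier ?G" for \<alpha>
    proof -
      have "\<forall>m \<in> ?S. \<exists>g. g \<in> Arr E \<and> Dom E g = Cod E m \<and> Cod E g = Cod E m \<and>
          Comp E g (\<alpha> m) = Ide E (Cod E m) \<and> Comp E (\<alpha> m) g = Ide E (Cod E m)"
        using \<alpha>(1)[OF A] unfolding automorphisms_def by blast
      then obtain \<beta> where b: "\<And>m. m \<in> ?S \<Longrightarrow> \<beta> m \<in> Arr E \<and> Dom E (\<beta> m) = Cod E m \<and>
          Cod E (\<beta> m) = Cod E m \<and> Comp E (\<beta> m) (\<alpha> m) = Ide E (Cod E m) \<and>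
          Comp E (\<alpha> m) (\<beta> m) = Ide E (Cod E m)"
        by metis
      have "Comp E (\<beta> (Comp E n m)) n = Comp E n (\<beta> m)"
        if mn: "m \<in> ?S" "n \<in> Arr E" "Dom E n = Cod E m" for m n
      proof -
        let ?k = "Comp E n m"
        note [simp] = \<alpha>[OF A mn(1)] \<alpha>[OF A Sn[OF mn]]
        have [simp]: "Cod E ?k = Cod E n"
          using mn S by (simp add: Cod_Comp)
        note b1 = b[OF mn(1)] and b2 = b[OF Sn[OF mn], simplified]
        have "Comp E (\<beta> ?k) n = Comp E (\<beta> ?k) (Comp E n (Comp E (\<alpha> m) (\<beta> m)))"
          using mn b1 Comp_Ide_right[of n] by simp
        also have "\<dots> = Comp E (\<beta> ?k) (Comp E (Comp E n (\<alpha> m)) (\<beta> m))"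
          using mn b1 by (simp add: Comp_assoc)
        also have "\<dots> = Comp E (\<beta> ?k) (Comp E (Comp E (\<alpha> ?k) n) (\<beta> m))"
          using nat[OF A mn] by simp
        also have "\<dots> = Comp E (Comp E (\<beta> ?k) (\<alpha> ?k)) (Comp E n (\<beta> m))"
          using mn b1 b2 Comp_assoc[of "Comp E n (\<beta> m)" "\<alpha> ?k" "\<beta> ?k"]
          by (simp add: Comp_assoc Comp_in Cod_Comp)
        also have "\<dots> = Comp E n (\<beta> m)"
          using mn b1 b2 Comp_Ide_left[of "Comp E n (\<beta> m)"] by (simp add: Comp_in Cod_Comp)
        finally show ?thesis .
      qed
      moreover have "\<beta> m \<in> automorphisms E (Cod E m)" if "m \<in> ?S" for m
        using b[OF that] \<alpha>[OF A that] unfolding automorphisms_def by blast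
      ultimately have "restrict \<beta> ?S \<in> carrier ?G"
        by (auto simp: isotropy_group_def Sn)
      moreover have "restrict \<beta> ?S \<otimes>\<^bsub>?G\<^esub> \<alpha> = \<one>\<^bsub>?G\<^esub>"
        using b by (auto simp: mult one restrict_def fun_eq_iff)
      ultimately show ?thesis by blast
    qed
  qed (use closed in auto)
qed

end

theory Submission
  imports Defs
begin

text \<open>
  An invertible object \<open>a\<close> of \<open>C\<close> acts on every \<open>m : C \<rightarrow> D\<close> by the conjugation
  \<open>m a \<otimes> - \<otimes> m a\<^sup>-\<^sup>1\<close>.  Conversely, let \<open>E\<close> be \<open>C\<close> with an arrow \<open>f : x \<rightarrow> y\<close> freely
  adjoined.  Its objects and arrows are words \<open>c\<^sub>0 k\<^sub>1 c\<^sub>1 \<dots> k\<^sub>n c\<^sub>n\<close>, with the \<open>c\<^sub>i\<close> from \<open>C\<close> and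
  the \<open>k\<^sub>i\<close> from the arrow category, and composition is letterwise.  By naturality an isotropy
  element \<open>\<alpha>\<close> is determined by its values at \<open>x\<close> and \<open>f\<close> in \<open>E\<close>.  Multiplicativity of \<open>\<alpha>\<close> forces
  \<open>\<alpha> x = a x b\<close> with \<open>a b = b a = I\<close>; then \<open>\<alpha> f = u f v\<close> with arrows \<open>u\<close>, \<open>v\<close> of \<open>C\<close>, and sending
  \<open>f\<close> to the identity of \<open>x\<close> shows that \<open>u\<close> and \<open>v\<close> are identities.  Since \<open>U\<close> contains an infinite
  set, \<open>E\<close> has a copy in \<open>U\<close>.
\<close>

section \<open>Adjoining a category freely to a strict monoidal category\<close>

datatype ('a, 'k) word = End 'a | Step 'a 'k "('a, 'k) word"

inductive_set words :: "'a set \<Rightarrow> 'k set \<Rightarrow> ('a, 'k) word set" for A K where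
  End: "a \<in> A \<Longrightarrow> End a \<in> words A K"
| Step: "\<lbrakk>a \<in> A; k \<in> K; w \<in> words A K\<rbrakk> \<Longrightarrow> Step a k w \<in> words A K"

lemma End_in_words_iff [simp]: "End a \<in> words A K \<longleftrightarrow> a \<in> A"
  by (auto intro: words.intros elim: words.cases)

lemma Step_in_words_iff [simp]: "Step a k w \<in> words A K \<longleftrightarrow> a \<in> A \<and> k \<in> K \<and> w \<in> words A K"
  by (auto intro: words.intros elim: words.cases)

fun wapp :: "('a \<Rightarrow> 'a \<Rightarrow> 'a) \<Rightarrow> ('a, 'k) word \<Rightarrow> ('a, 'k) word \<Rightarrow> ('a, 'k) word" where
  "wapp t (End a) (End b) = End (t a b)"
| "wapp t (End a) (Step b k w) = Step (t a b) k w"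
| "wapp t (Step a k v) w = Step a k (wapp t v w)"

text \<open>The last equation is junk: only words of equal length are ever zipped.\<close>

fun wzip :: "('a \<Rightarrow> 'a \<Rightarrow> 'a) \<Rightarrow> ('k \<Rightarrow> 'k \<Rightarrow> 'k) \<Rightarrow> ('a, 'k) word \<Rightarrow> ('a, 'k) word \<Rightarrow> ('a, 'k) word"
  where
  "wzip c d (End a) (End b) = End (c a b)"
| "wzip c d (Step a k v) (Step b l w) = Step (c a b) (d k l) (wzip c d v w)"
| "wzip c d v w = v"

text \<open>The induced map out of the free product, given by \<open>f\<close> on coefficients and
  by \<open>g\<close> on letters.\<close>

fun weval :: "('b \<Rightarrow> 'b \<Rightarrow> 'b) \<Rightarrow> ('a \<Rightarrow> 'b) \<Rightarrow> ('k \<Rightarrow> 'b) \<Rightarrow> ('a, 'k) word \<Rightarrow> 'b" where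
  "weval t f g (End a) = f a"
| "weval t f g (Step a k w) = t (f a) (t (g k) (weval t f g w))"

lemma wapp_in_words:
  assumes "v \<in> words A K" "w \<in> words A K" "\<And>a b. \<lbrakk>a \<in> A; b \<in> A\<rbrakk> \<Longrightarrow> t a b \<in> A"
  shows "wapp t v w \<in> words A K"
  using assms(1)
proof induction
  case (End a)
  then show ?case
    using assms(2) by (cases w) (auto simp: assms(3))
qed (auto simp: assms(2))

text \<open>The coproduct of \<open>C\<close> with the free strict monoidal category on
  \<open>K\<close>. Its arrows preserve the number of letters from \<open>K\<close>.\<close>

definition adjoin :: "('o, 'm) moncat \<Rightarrow> ('p, 'n) cat \<Rightarrow> (('o, 'p) word, ('m, 'n) word) moncat" where
  "adjoin C K =
    \<lparr>Obj = words (Obj C) (Obj K), Arr = words (Arr C) (Arr K),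
     Dom = map_word (Dom C) (Dom K), Cod = map_word (Cod C) (Cod K),
     Ide = map_word (Ide C) (Ide K), Comp = wzip (Comp C) (Comp K),
     TensO = wapp (TensO C), TensA = wapp (TensA C), UnitO = End (UnitO C)\<rparr>"

lemma adjoin_simps [simp]:
  "Obj (adjoin C K) = words (Obj C) (Obj K)"
  "Arr (adjoin C K) = words (Arr C) (Arr K)"
  "Dom (adjoin C K) = map_word (Dom C) (Dom K)"
  "Cod (adjoin C K) = map_word (Cod C) (Cod K)"
  "Ide (adjoin C K) = map_word (Ide C) (Ide K)"
  "Comp (adjoin C K) = wzip (Comp C) (Comp K)"
  "TensO (adjoin C K) = wapp (TensO C)"
  "TensA (adjoin C K) = wapp (TensA C)"
  "UnitO (adjoin C K) = End (UnitO C)"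
  by (simp_all add: adjoin_def)

lemma map_word_in_words:
  assumes "w \<in> words A K" "\<And>a. a \<in> A \<Longrightarrow> f a \<in> B" "\<And>k. k \<in> K \<Longrightarrow> g k \<in> L"
  shows "map_word f g w \<in> words B L"
  using assms(1) by induction (auto simp: assms)

lemma map_word_wapp:
  assumes "v \<in> words A K" "w \<in> words A K"
    and "\<And>a b. \<lbrakk>a \<in> A; b \<in> A\<rbrakk> \<Longrightarrow> f (t a b) = t' (f a) (f b)"
  shows "map_word f g (wapp t v w) = wapp t' (map_word f g v) (map_word f g w)"
  using assms(1)
proof induction
  case (End a)
  then show ?case
    using assms(2) by (cases w) (auto simp: assms(3))
qed simp

lemma map_word_eq_self:
  assumes "w \<in> words A K" "\<And>a. a \<in> A \<Longrightarrow> f a = a" "\<And>k. k \<in> K \<Longrightarrow> g k = k"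
  shows "map_word f g w = w"
  using assms(1) by induction (auto simp: assms)

lemma map_word_eq_End: "map_word f g w = End b \<longleftrightarrow> (\<exists>a. w = End a \<and> f a = b)"
  by (cases w) auto

lemma map_word_eq_Step:
  "map_word f g w = Step b l v \<longleftrightarrow> (\<exists>a k u. w = Step a k u \<and> f a = b \<and> g k = l \<and> map_word f g u = v)"
  by (cases w) auto

lemma wapp_assoc:
  assumes "u \<in> words A K" "v \<in> words A K" "w \<in> words A K"
    and "\<And>a b c. \<lbrakk>a \<in> A; b \<in> A; c \<in> A\<rbrakk> \<Longrightarrow> t (t a b) c = t a (t b c)"
  shows "wapp t (wapp t u v) w = wapp t u (wapp t v w)"
  using assms(1)
proof induction
  case (End a)
  with assms(2-4) show ?case
    by (cases v; cases w) auto
qed simp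

lemma wapp_unit_left:
  assumes "w \<in> words A K" "\<And>a. a \<in> A \<Longrightarrow> t e a = a"
  shows "wapp t (End e) w = w"
  using assms by (cases w) auto

lemma wapp_unit_right:
  assumes "w \<in> words A K" "\<And>a. a \<in> A \<Longrightarrow> t a e = a"
  shows "wapp t w (End e) = w"
  using assms(1) by induction (auto simp: assms(2))

section \<open>Words form a strict monoidal category\<close>

locale adjunction_data = C: strict_monoidal_category C + K: category K
  for C :: "('o, 'm) moncat" and K :: "('p, 'n) cat"
begin

text \<open>Matching codomain and domain force \<open>f\<close> and \<open>g\<close> to have the
  same shape, so the junk equation of \<open>wzip\<close> never applies and each claim is checked
  letter by letter.\<close>

lemma wzip_facts:
  assumes "f \<in> words (Arr C) (Arr K)" "g \<in> words (Arr C) (Arr K)"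
    and "map_word (Cod C) (Cod K) f = map_word (Dom C) (Dom K) g"
  shows "wzip (Comp C) (Comp K) g f \<in> words (Arr C) (Arr K)" (is ?in)
    and "map_word (Dom C) (Dom K) (wzip (Comp C) (Comp K) g f) = map_word (Dom C) (Dom K) f" (is ?dom)
    and "map_word (Cod C) (Cod K) (wzip (Comp C) (Comp K) g f) = map_word (Cod C) (Cod K) g" (is ?cod)
proof -
  have "?in \<and> ?dom \<and> ?cod"
    using assms
  proof (induction f arbitrary: g)
    case (End a)
    then show ?case
      by (cases g) (auto simp: C.Comp_in C.Dom_Comp C.Cod_Comp)
  next
    case (Step a k f)
    then show ?case
      by (cases g) (auto simp: C.Comp_in C.Dom_Comp C.Cod_Comp K.Comp_in K.Dom_Comp K.Cod_Comp)
  qed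
  then show ?in ?dom ?cod by auto
qed

lemma wzip_assoc:
  assumes "f \<in> words (Arr C) (Arr K)" "g \<in> words (Arr C) (Arr K)" "h \<in> words (Arr C) (Arr K)"
    and "map_word (Cod C) (Cod K) f = map_word (Dom C) (Dom K) g"
    and "map_word (Cod C) (Cod K) g = map_word (Dom C) (Dom K) h"
  shows "wzip (Comp C) (Comp K) (wzip (Comp C) (Comp K) h g) f
       = wzip (Comp C) (Comp K) h (wzip (Comp C) (Comp K) g f)"
  using assms
proof (induction f arbitrary: g h)
  case (End a)
  then show ?case
    by (cases g; cases h) (auto simp: C.Comp_assoc)
next
  case (Step a k f)
  then show ?case
    by (cases g; cases h) (auto simp: C.Comp_assoc K.Comp_assoc)
qed

lemma wzip_Ide:
  assumes "f \<in> words (Arr C) (Arr K)"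
  shows "wzip (Comp C) (Comp K) f (map_word (Ide C) (Ide K) (map_word (Dom C) (Dom K) f)) = f"
    and "wzip (Comp C) (Comp K) (map_word (Ide C) (Ide K) (map_word (Cod C) (Cod K) f)) f = f"
  by (use assms in induction, auto simp: C.Comp_Ide_left C.Comp_Ide_right K.Comp_Ide_left K.Comp_Ide_right)

text \<open>Composable words break at the same places, so interchange in \<open>C\<close> is needed
  only for the coefficient at the joint.\<close>

lemma wapp_wzip:
  assumes "f \<in> words (Arr C) (Arr K)" "g \<in> words (Arr C) (Arr K)"
    "f' \<in> words (Arr C) (Arr K)" "g' \<in> words (Arr C) (Arr K)"
    and "map_word (Cod C) (Cod K) f = map_word (Dom C) (Dom K) g"
    and "map_word (Cod C) (Cod K) f' = map_word (Dom C) (Dom K) g'"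
  shows "wapp (TensA C) (wzip (Comp C) (Comp K) g f) (wzip (Comp C) (Comp K) g' f')
       = wzip (Comp C) (Comp K) (wapp (TensA C) g g') (wapp (TensA C) f f')"
  using assms
proof (induction f arbitrary: g)
  case (End a)
  then show ?case
    by (cases g; cases f'; cases g') (auto simp: C.TensA_Comp)
next
  case (Step a k f)
  then show ?case
    by (cases g) auto
qed

sublocale E: strict_monoidal_category "adjoin C K"
proof (unfold_locales, goal_cases)
  case (15 f g) then show ?case
    by (auto intro!: map_word_wapp simp: C.Dom_TensA)
next
  case (16 f g) then show ?case
    by (auto intro!: map_word_wapp simp: C.Cod_TensA)
next
  case (17 f g) then show ?case
    by (auto intro!: map_word_wapp[symmetric] simp: C.TensA_Ide)
next
  case (18 f g f' g') then show ?case
    using wapp_wzip[of f g f' g'] by simp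
next
  case (9 f g h) then show ?case
    using wzip_assoc[of f g h] by simp
next
  case (10 f) then show ?case
    using wzip_Ide(1)[of f] by simp
next
  case (11 f) then show ?case
    using wzip_Ide(2)[of f] by simp
qed (auto simp: C.Dom_in C.Cod_in C.Ide_in C.UnitO_in C.TensO_in C.TensA_in C.TensO_assoc C.TensA_assoc
      C.TensO_UnitO_left C.TensO_UnitO_right C.TensA_UnitO_left C.TensA_UnitO_right
      C.Dom_Ide C.Cod_Ide K.Dom_Ide K.Cod_Ide word.map_comp o_def
      K.Dom_in K.Cod_in K.Ide_in wzip_facts
      intro!: map_word_in_words wapp_in_words wapp_assoc wapp_unit_left wapp_unit_right
        map_word_eq_self)

end

section \<open>Strict monoidal maps between categories of different types\<close>

text \<open>The record \<open>smfunctor\<close> has the same types at source and target, whereas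
  words live in types of their own. Values outside the carriers are left arbitrary here;
  \<open>functor_of\<close> restricts them.\<close>

locale monoidal_map = S: strict_monoidal_category C + T: strict_monoidal_category D
  for C :: "('o, 'm) moncat" and D :: "('p, 'n) moncat" +
  fixes fo :: "'o \<Rightarrow> 'p" and fa :: "'m \<Rightarrow> 'n"
  assumes fo_in: "x \<in> Obj C \<Longrightarrow> fo x \<in> Obj D"
    and fa_in: "f \<in> Arr C \<Longrightarrow> fa f \<in> Arr D"
    and Dom_fa: "f \<in> Arr C \<Longrightarrow> Dom D (fa f) = fo (Dom C f)"
    and Cod_fa: "f \<in> Arr C \<Longrightarrow> Cod D (fa f) = fo (Cod C f)"
    and fa_Ide: "x \<in> Obj C \<Longrightarrow> fa (Ide C x) = Ide D (fo x)"
    and fa_Comp: "\<lbrakk>f \<in> Arr C; g \<in> Arr C; Cod C f = Dom C g\<rbrakk>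
      \<Longrightarrow> fa (Comp C g f) = Comp D (fa g) (fa f)"
    and fo_UnitO: "fo (UnitO C) = UnitO D"
    and fo_TensO: "\<lbrakk>x \<in> Obj C; y \<in> Obj C\<rbrakk> \<Longrightarrow> fo (TensO C x y) = TensO D (fo x) (fo y)"
    and fa_TensA: "\<lbrakk>f \<in> Arr C; g \<in> Arr C\<rbrakk> \<Longrightarrow> fa (TensA C f g) = TensA D (fa f) (fa g)"

lemma monoidal_map_comp:
  assumes "monoidal_map C D fo fa" "monoidal_map D E go ga"
  shows "monoidal_map C E (\<lambda>x. go (fo x)) (\<lambda>f. ga (fa f))"
proof -
  interpret F: monoidal_map C D fo fa by fact
  interpret G: monoidal_map D E go ga by fact
  show ?thesis
    by unfold_locales
      (auto simp: F.fo_in F.fa_in F.Dom_fa F.Cod_fa F.fa_Ide F.fa_Comp F.fo_UnitO F.fo_TensO F.fa_TensA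
        G.fo_in G.fa_in G.Dom_fa G.Cod_fa G.fa_Ide G.fa_Comp G.fo_UnitO G.fo_TensO G.fa_TensA)
qed

definition functor_of ::
    "('o, 'm) moncat \<Rightarrow> ('o, 'm) moncat \<Rightarrow> ('o \<Rightarrow> 'o) \<Rightarrow> ('m \<Rightarrow> 'm) \<Rightarrow> ('o, 'm) smfunctor" where
  "functor_of C D fo fa = \<lparr>Src = C, Tgt = D, OMap = restrict fo (Obj C), AMap = restrict fa (Arr C)\<rparr>"

lemma functor_of_simps [simp]:
  "Src (functor_of C D fo fa) = C"
  "Tgt (functor_of C D fo fa) = D"
  "OMap (functor_of C D fo fa) = restrict fo (Obj C)"
  "AMap (functor_of C D fo fa) = restrict fa (Arr C)"
  by (simp_all add: functor_of_def)

lemma functor_of_cong: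
  assumes "\<And>x. x \<in> Obj C \<Longrightarrow> fo x = go x" "\<And>f. f \<in> Arr C \<Longrightarrow> fa f = ga f"
  shows "functor_of C D fo fa = functor_of C D go ga"
  using assms by (auto simp: functor_of_def intro!: restrict_ext)

lemma strict_monoidal_functor_functor_of:
  assumes "monoidal_map C D fo fa"
  shows "strict_monoidal_functor (functor_of C D fo fa)"
proof -
  interpret F: monoidal_map C D fo fa by fact
  show ?thesis
    by (rule strict_monoidal_functor.intro)
      (auto simp: F.S.strict_monoidal_category_axioms F.T.strict_monoidal_category_axioms
        F.fo_in F.fa_in F.Dom_fa F.Cod_fa F.fa_Ide F.fa_Comp F.fo_UnitO F.fo_TensO F.fa_TensA
        F.S.Dom_in F.S.Cod_in F.S.Ide_in F.S.Comp_in F.S.UnitO_in F.S.TensO_in F.S.TensA_in)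
qed

lemma monoidal_map_functor:
  assumes "strict_monoidal_functor F"
  shows "monoidal_map (Src F) (Tgt F) (OMap F) (AMap F)"
proof -
  interpret F: strict_monoidal_functor F by fact
  interpret S: strict_monoidal_category "Src F" by (rule F.Src)
  interpret T: strict_monoidal_category "Tgt F" by (rule F.Tgt)
  show ?thesis
    by unfold_locales
      (use F.OMap F.AMap in \<open>auto simp: F.Dom_AMap F.Cod_AMap F.AMap_Ide F.AMap_Comp F.OMap_UnitO
        F.OMap_TensO F.AMap_TensA\<close>)
qed

lemma functor_eq_functor_of:
  assumes "strict_monoidal_functor F"
  shows "F = functor_of (Src F) (Tgt F) (OMap F) (AMap F)"
proof -
  interpret F: strict_monoidal_functor F by fact
  show ?thesis
    using F.OMap F.AMap
    by (intro smfunctor.equality) (auto simp: PiE_def extensional_restrict)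
qed

lemma StrMonCat_simps [simp]:
  "Obj (StrMonCat U) = {C. small_strict_monoidal_category U C}"
  "Arr (StrMonCat U) = {F. strict_monoidal_functor F \<and>
       small_strict_monoidal_category U (Src F) \<and> small_strict_monoidal_category U (Tgt F)}"
  "Dom (StrMonCat U) = Src"
  "Cod (StrMonCat U) = Tgt"
  "Ide (StrMonCat U) C = functor_of C C (\<lambda>x. x) (\<lambda>f. f)"
  by (simp_all add: StrMonCat_def functor_of_def)

lemma Comp_functor_of:
  assumes "monoidal_map C D fo fa"
  shows "Comp (StrMonCat U) (functor_of D E go ga) (functor_of C D fo fa)
    = functor_of C E (\<lambda>x. go (fo x)) (\<lambda>f. ga (fa f))"
proof -
  interpret F: monoidal_map C D fo fa by fact
  show ?thesis
    by (auto simp: StrMonCat_def functor_of_def compose_def F.fo_in F.fa_in intro!: restrict_ext)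
qed

section \<open>Transport along injections\<close>

text \<open>Decodes with \<open>inv_into\<close>, operates in \<open>E\<close> and encodes again.
  This is how a category of words gets a copy on the type underlying the universe.\<close>

definition transport ::
    "('o, 'm) moncat \<Rightarrow> ('o \<Rightarrow> 'p) \<Rightarrow> ('m \<Rightarrow> 'n) \<Rightarrow> ('p, 'n) moncat" where
  "transport E eo em = (let io = inv_into (Obj E) eo; im = inv_into (Arr E) em in
    \<lparr>Obj = eo ` Obj E, Arr = em ` Arr E,
     Dom = (\<lambda>f. eo (Dom E (im f))), Cod = (\<lambda>f. eo (Cod E (im f))),
     Ide = (\<lambda>x. em (Ide E (io x))), Comp = (\<lambda>g f. em (Comp E (im g) (im f))),
     TensO = (\<lambda>x y. eo (TensO E (io x) (io y))), TensA = (\<lambda>f g. em (TensA E (im f) (im g))),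
     UnitO = eo (UnitO E)\<rparr>)"

lemma transport_facts:
  assumes "strict_monoidal_category E" "inj_on eo (Obj E)" "inj_on em (Arr E)"
  shows strict_monoidal_category_transport: "strict_monoidal_category (transport E eo em)"
    and monoidal_map_transport: "monoidal_map E (transport E eo em) eo em"
    and monoidal_map_transport_inv:
      "monoidal_map (transport E eo em) E (inv_into (Obj E) eo) (inv_into (Arr E) em)"
proof -
  interpret E: strict_monoidal_category E by fact
  note inj = inv_into_f_f[OF assms(2)] inv_into_f_f[OF assms(3)]
  note clo = E.Dom_in E.Cod_in E.Ide_in E.Comp_in E.UnitO_in E.TensO_in E.TensA_in
  note eqs = E.Dom_Ide E.Cod_Ide E.Dom_Comp E.Cod_Comp E.Comp_assoc E.Comp_Ide_right E.Comp_Ide_left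
    E.Dom_TensA E.Cod_TensA E.TensA_Ide E.TensA_Comp E.TensO_assoc E.TensO_UnitO_left
    E.TensO_UnitO_right E.TensA_assoc E.TensA_UnitO_left E.TensA_UnitO_right
  show *: "strict_monoidal_category (transport E eo em)"
    by unfold_locales
      (auto simp: transport_def Let_def inj clo eqs inj_on_eq_iff[OF assms(2)])
  interpret T: strict_monoidal_category "transport E eo em" by fact
  show "monoidal_map E (transport E eo em) eo em"
    by unfold_locales (auto simp: transport_def Let_def inj clo)
  show "monoidal_map (transport E eo em) E (inv_into (Obj E) eo) (inv_into (Arr E) em)"
    by unfold_locales (auto simp: transport_def Let_def inj clo inj_on_eq_iff[OF assms(2)])
qed

section \<open>Evaluating words\<close>

locale functor_map = S: category K + T: category D
  for K :: "('k, 'l) cat" and D :: "('o, 'm, 'z) cat_scheme" +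
  fixes po :: "'k \<Rightarrow> 'o" and pa :: "'l \<Rightarrow> 'm"
  assumes po_in: "x \<in> Obj K \<Longrightarrow> po x \<in> Obj D"
    and pa_in: "f \<in> Arr K \<Longrightarrow> pa f \<in> Arr D"
    and Dom_pa: "f \<in> Arr K \<Longrightarrow> Dom D (pa f) = po (Dom K f)"
    and Cod_pa: "f \<in> Arr K \<Longrightarrow> Cod D (pa f) = po (Cod K f)"
    and pa_Ide: "x \<in> Obj K \<Longrightarrow> pa (Ide K x) = Ide D (po x)"
    and pa_Comp: "\<lbrakk>f \<in> Arr K; g \<in> Arr K; Cod K f = Dom K g\<rbrakk>
      \<Longrightarrow> pa (Comp K g f) = Comp D (pa g) (pa f)"

lemma weval_in:
  assumes "w \<in> words A K" "\<And>a. a \<in> A \<Longrightarrow> f a \<in> B" "\<And>k. k \<in> K \<Longrightarrow> g k \<in> B"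
    and "\<And>a b. \<lbrakk>a \<in> B; b \<in> B\<rbrakk> \<Longrightarrow> t a b \<in> B"
  shows "weval t f g w \<in> B"
  using assms(1) by induction (auto simp: assms(2-))

text \<open>Concatenation changes only the coefficient at the joint, where multiplicativity of
  \<open>f\<close> is used. Reassociating the rest takes place in \<open>B\<close>, the set on which
  \<open>t\<close> is known to be associative.\<close>

lemma weval_wapp:
  assumes "v \<in> words A K" "w \<in> words A K"
    and "\<And>a. a \<in> A \<Longrightarrow> f a \<in> B" "\<And>k. k \<in> K \<Longrightarrow> g k \<in> B"
    and "\<And>a b. \<lbrakk>a \<in> B; b \<in> B\<rbrakk> \<Longrightarrow> t a b \<in> B"
    and "\<And>a b c. \<lbrakk>a \<in> B; b \<in> B; c \<in> B\<rbrakk> \<Longrightarrow> t (t a b) c = t a (t b c)"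
    and "\<And>a b. \<lbrakk>a \<in> A; b \<in> A\<rbrakk> \<Longrightarrow> f (s a b) = t (f a) (f b)"
  shows "weval t f g (wapp s v w) = t (weval t f g v) (weval t f g w)"
  using assms(1)
proof induction
  case (End a)
  have in_B: "weval t f g u \<in> B" if "u \<in> words A K" for u
    by (rule weval_in[OF that]) (use assms(3-5) in auto)
  from End show ?case
    using assms(2) in_B by (cases w) (auto simp: assms(3-))
next
  case (Step a k v)
  have "weval t f g u \<in> B" if "u \<in> words A K" for u
    by (rule weval_in[OF that]) (use assms(3-5) in auto)
  with Step show ?case
    using assms(2) by (simp add: assms(3-))
qed

locale evaluation = adjunction_data C K + M: monoidal_map C D mo ma + P: functor_map K D po pa
  for C :: "('o, 'm) moncat" and K :: "('k, 'l) cat" and D :: "('p, 'n) moncat" and mo ma po pa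
begin

abbreviation evo :: "('o, 'k) word \<Rightarrow> 'p" where "evo \<equiv> weval (TensO D) mo po"
abbreviation eva :: "('m, 'l) word \<Rightarrow> 'n" where "eva \<equiv> weval (TensA D) ma pa"

lemma eva_in: "w \<in> words (Arr C) (Arr K) \<Longrightarrow> eva w \<in> Arr D"
  by (erule weval_in) (auto simp: M.fa_in P.pa_in M.T.TensA_in)

lemma Dom_eva: "w \<in> words (Arr C) (Arr K) \<Longrightarrow> Dom D (eva w) = evo (map_word (Dom C) (Dom K) w)"
  by (induction rule: words.induct)
    (auto simp: M.Dom_fa P.Dom_pa M.T.Dom_TensA M.T.TensA_in M.fa_in P.pa_in eva_in)

lemma Cod_eva: "w \<in> words (Arr C) (Arr K) \<Longrightarrow> Cod D (eva w) = evo (map_word (Cod C) (Cod K) w)"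
  by (induction rule: words.induct)
    (auto simp: M.Cod_fa P.Cod_pa M.T.Cod_TensA M.T.TensA_in M.fa_in P.pa_in eva_in)

lemma evo_in: "w \<in> words (Obj C) (Obj K) \<Longrightarrow> evo w \<in> Obj D"
  by (erule weval_in) (auto simp: M.fo_in P.po_in M.T.TensO_in)

lemma eva_Ide: "w \<in> words (Obj C) (Obj K) \<Longrightarrow> eva (map_word (Ide C) (Ide K) w) = Ide D (evo w)"
  by (induction rule: words.induct)
    (auto simp: M.fa_Ide P.pa_Ide M.T.TensA_Ide M.T.TensO_in M.fo_in P.po_in evo_in)

lemma eva_wzip:
  assumes "f \<in> words (Arr C) (Arr K)" "g \<in> words (Arr C) (Arr K)"
    and "map_word (Cod C) (Cod K) f = map_word (Dom C) (Dom K) g"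
  shows "eva (wzip (Comp C) (Comp K) g f) = Comp D (eva g) (eva f)"
  using assms
proof (induction f arbitrary: g)
  case (End a)
  then show ?case
    by (cases g) (auto simp: M.fa_Comp)
next
  case (Step a k f)
  then obtain b l h where g: "g = Step b l h" and h: "b \<in> Arr C" "l \<in> Arr K" "h \<in> words (Arr C) (Arr K)"
      "Cod C a = Dom C b" "Cod K k = Dom K l" "map_word (Cod C) (Cod K) f = map_word (Dom C) (Dom K) h"
    by (cases g) auto
  \<comment> \<open>Interchange in \<open>D\<close> requires the evaluated tails to be
    composable.\<close>
  have "Cod D (eva f) = Dom D (eva h)"
    using Step h by (simp add: Dom_eva Cod_eva)
  then show ?case
    using Step h g
    by (simp add: M.fa_Comp P.pa_Comp M.T.TensA_Comp M.fa_in P.pa_in eva_in M.T.TensA_in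
        M.Dom_fa M.Cod_fa P.Dom_pa P.Cod_pa M.T.Dom_TensA M.T.Cod_TensA)
qed

text \<open>The existence half of the universal property of \<open>adjoin C K\<close>.\<close>

lemma monoidal_map_eval: "monoidal_map (adjoin C K) D evo eva"
proof (unfold_locales, goal_cases)
  case (6 f g) then show ?case
    by (simp add: eva_wzip)
next
  case (8 x y) then show ?case
    by simp (rule weval_wapp[where B = "Obj D"],
      auto simp: M.fo_in P.po_in M.T.TensO_in M.T.TensO_assoc M.fo_TensO)
next
  case (9 x y) then show ?case
    by simp (rule weval_wapp[where B = "Arr D"],
      auto simp: M.fa_in P.pa_in M.T.TensA_in M.T.TensA_assoc M.fa_TensA)
qed (auto simp: eva_in evo_in Dom_eva Cod_eva eva_Ide M.fo_UnitO)

end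

text \<open>The two-element order as a category. \<open>False\<close> and \<open>True\<close> are
  the free objects x and y, and \<open>(False, True)\<close> is the free arrow between them.\<close>

definition arrow_cat :: "(bool, bool \<times> bool) cat" where
  "arrow_cat = \<lparr>Obj = UNIV, Arr = {(p, q). p \<le> q}, Dom = fst, Cod = snd,
     Ide = (\<lambda>p. (p, p)), Comp = (\<lambda>g f. (fst f, snd g))\<rparr>"

lemma arrow_cat_simps [simp]:
  "Obj arrow_cat = UNIV"
  "Arr arrow_cat = {(p, q). p \<le> q}"
  "Dom arrow_cat = fst"
  "Cod arrow_cat = snd"
  "Ide arrow_cat = (\<lambda>p. (p, p))"
  "Comp arrow_cat = (\<lambda>g f. (fst f, snd g))"
  by (simp_all add: arrow_cat_def)

lemma category_arrow_cat: "category arrow_cat"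
  by unfold_locales auto

definition point_obj :: "('o, 'm, 'z) cat_scheme \<Rightarrow> 'm \<Rightarrow> bool \<Rightarrow> 'o" where
  "point_obj D g p = (if p then Cod D g else Dom D g)"

definition point_arr :: "('o, 'm, 'z) cat_scheme \<Rightarrow> 'm \<Rightarrow> bool \<times> bool \<Rightarrow> 'm" where
  "point_arr D g f = (if fst f = snd f then Ide D (point_obj D g (fst f)) else g)"

lemma functor_map_point:
  assumes "category D" "g \<in> Arr D"
  shows "functor_map arrow_cat D (point_obj D g) (point_arr D g)"
proof -
  interpret K: category arrow_cat by (rule category_arrow_cat)
  interpret D: category D by fact
  have ide: "Comp D (Ide D x) (Ide D x) = Ide D x" if "x \<in> Obj D" for x
    using D.Comp_Ide_left[of "Ide D x"] that by (simp add: D.Ide_in D.Cod_Ide)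
  show ?thesis
    by unfold_locales
      (auto simp: point_obj_def point_arr_def assms(2) D.Dom_in D.Cod_in D.Ide_in D.Dom_Ide D.Cod_Ide
        D.Comp_Ide_left D.Comp_Ide_right ide)
qed

section \<open>Smallness\<close>

text \<open>\<open>p\<close> serves as a pairing function, and the tags \<open>s\<close> and
  \<open>t\<close> tell the two constructors apart.\<close>

fun wcode :: "('u \<times> 'u \<Rightarrow> 'u) \<Rightarrow> 'u \<Rightarrow> 'u \<Rightarrow> ('a \<Rightarrow> 'u) \<Rightarrow> ('k \<Rightarrow> 'u) \<Rightarrow> ('a, 'k) word \<Rightarrow> 'u" where
  "wcode p s t j k (End a) = p (s, j a)"
| "wcode p s t j k (Step a l w) = p (t, p (j a, p (k l, wcode p s t j k w)))"

lemma wcode_in: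
  assumes "w \<in> words A K" "p \<in> B \<times> B \<rightarrow> B" "s \<in> B" "t \<in> B" "j \<in> A \<rightarrow> B" "k \<in> K \<rightarrow> B"
  shows "wcode p s t j k w \<in> B"
  using assms(1) by induction (use assms(2-) in \<open>auto simp: Pi_iff\<close>)

lemma inj_on_wcode:
  assumes "inj_on p (B \<times> B)" "p \<in> B \<times> B \<rightarrow> B" "s \<in> B" "t \<in> B" "s \<noteq> t"
    and "inj_on j A" "j \<in> A \<rightarrow> B" "inj_on k K" "k \<in> K \<rightarrow> B"
  shows "inj_on (wcode p s t j k) (words A K)"
proof (rule inj_onI)
  have p: "p (x, y) = p (x', y') \<longleftrightarrow> x = x' \<and> y = y'"
    if "x \<in> B" "y \<in> B" "x' \<in> B" "y' \<in> B" for x y x' y'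
    using inj_on_eq_iff[OF assms(1), of "(x, y)" "(x', y')"] that by auto
  have B: "p (x, y) \<in> B" if "x \<in> B" "y \<in> B" for x y
    using assms(2) that by auto
  have j: "j a \<in> B" if "a \<in> A" for a using assms(7) that by auto
  have k: "k l \<in> B" if "l \<in> K" for l using assms(9) that by auto
  have code: "wcode p s t j k u \<in> B" if "u \<in> words A K" for u
    by (rule wcode_in[OF that]) (use assms in auto)
  show "v = w"
    if "v \<in> words A K" "w \<in> words A K" "wcode p s t j k v = wcode p s t j k w" for v w
    using that
  proof (induction v arbitrary: w)
    case (End a)
    then show ?case
      using assms(3-5)
      by (cases w) (auto simp: p B j k code inj_on_eq_iff[OF assms(6)])
  next
    case (Step a l v)
    note IH = Step.IH and Step = Step.hyps Step.prems
    show ?case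
    proof (cases w)
      case (End b)
      then show ?thesis
        using Step assms(3-5) by (simp add: p B j k code)
    next
      case (Step b m u)
      then have "a = b \<and> l = m \<and> wcode p s t j k v = wcode p s t j k u"
        using \<open>a \<in> A\<close> \<open>l \<in> K\<close> \<open>v \<in> words A K\<close> \<open>w \<in> words A K\<close>
          \<open>wcode p s t j k (Step a l v) = wcode p s t j k w\<close> assms(3-5)
        by (simp add: p B j k code inj_on_eq_iff[OF assms(6)] inj_on_eq_iff[OF assms(8)])
      then show ?thesis
        using IH[of u] Step \<open>w \<in> words A K\<close> by simp
    qed
  qed
qed

lemma lepoll_linear: "A \<lesssim> B \<or> B \<lesssim> A"
  unfolding lepoll_def
  by (metis card_of_Well_order card_of_ordLeq ordLeq_total)

lemma infinite_Times_lepoll: "infinite A \<Longrightarrow> A \<times> A \<lesssim> A"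
  unfolding lepoll_def
  by (metis card_of_Times_same_infinite card_of_ordLeq ordIso_iff_ordLeq)

text \<open>The larger of \<open>A\<close> and some infinite member of \<open>U\<close> is an
  infinite \<open>B\<close> in \<open>U\<close>. An injection of \<open>B \<times> B\<close> into
  \<open>B\<close> then codes all words inside \<open>B\<close>, and \<open>U\<close> is closed
  under smaller sets.\<close>

lemma universe_words:
  fixes U :: "'u set set" and A :: "'u set" and K :: "'k set"
  assumes "universe U" "A \<in> U" "finite K"
  shows "\<exists>c. inj_on c (words A K) \<and> c ` words A K \<in> U"
proof -
  obtain A' where A': "A' \<in> U" "infinite A'"
    using assms(1) by (auto simp: universe_def)
  obtain B where B: "B \<in> U" "infinite B" "A \<lesssim> B"
  proof (cases "A \<lesssim> A'")
    case True
    then show ?thesis using A' that by blast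
  next
    case False
    then have "A' \<lesssim> A" using lepoll_linear by blast
    then have "infinite A" using A'(2) infinite_le_lepoll lepoll_trans by blast
    then show ?thesis using assms(2) that lepoll_refl by blast
  qed
  obtain j where j: "inj_on j A" "j ` A \<subseteq> B"
    using B(3) by (auto simp: lepoll_def)
  obtain p where p: "inj_on p (B \<times> B)" "p ` (B \<times> B) \<subseteq> B"
    using infinite_Times_lepoll[OF B(2)] by (auto simp: lepoll_def)
  obtain k :: "'k \<Rightarrow> 'u" where k: "inj_on k K" "k ` K \<subseteq> B"
    using finite_lepoll_infinite[OF B(2) assms(3)] by (auto simp: lepoll_def)
  obtain s where s: "s \<in> B" using B(2) by fastforce
  have "B - {s} \<noteq> {}" using B(2) by (metis finite.emptyI infinite_remove)
  then obtain t where t: "t \<in> B" "s \<noteq> t" by blast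
  have "inj_on (wcode p s t j k) (words A K)"
    by (rule inj_on_wcode[of p B]) (use j p k s t in auto)
  moreover have "wcode p s t j k ` words A K \<subseteq> B"
    using j p k s t by (auto intro!: wcode_in[of _ A K])
  then have "wcode p s t j k ` words A K \<lesssim> B"
    by (rule subset_imp_lepoll)
  then have "wcode p s t j k ` words A K \<in> U"
    using assms(1) B(1) unfolding universe_def by blast
  ultimately show ?thesis by blast
qed

section \<open>Components of an isotropy element at a large test object\<close>

text \<open>\<open>E\<close> is a test category under \<open>C\<close> on arbitrary types. The
  encodings \<open>eo\<close> and \<open>em\<close> give it a copy in \<open>U\<close>, so that an
  isotropy element has a component there.\<close>

locale embeddable = I: monoidal_map C E io ia
  for U :: "'u set set" and C :: "('u, 'u) moncat" and E :: "('o, 'm) moncat" and io ia +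
  fixes eo :: "'o \<Rightarrow> 'u" and em :: "'m \<Rightarrow> 'u"
  assumes small: "small_strict_monoidal_category U C"
    and eo: "inj_on eo (Obj E)" "eo ` Obj E \<in> U"
    and em: "inj_on em (Arr E)" "em ` Arr E \<in> U"
begin

abbreviation deo :: "'u \<Rightarrow> 'o" where "deo \<equiv> inv_into (Obj E) eo"
abbreviation dem :: "'u \<Rightarrow> 'm" where "dem \<equiv> inv_into (Arr E) em"

definition "test = transport E eo em"
definition "incl = functor_of C test (\<lambda>x. eo (io x)) (\<lambda>f. em (ia f))"

lemmas enc = monoidal_map_transport[OF I.T.strict_monoidal_category_axioms eo(1) em(1), folded test_def]
lemmas dec = monoidal_map_transport_inv[OF I.T.strict_monoidal_category_axioms eo(1) em(1), folded test_def]
lemmas incl_map = monoidal_map_comp[OF I.monoidal_map_axioms enc]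

lemma test_Obj: "Obj test = eo ` Obj E" "Arr test = em ` Arr E"
  by (simp_all add: test_def transport_def Let_def)

lemma small_test: "small_strict_monoidal_category U test"
  unfolding small_strict_monoidal_category_def test_Obj
  using eo em strict_monoidal_category_transport[OF I.T.strict_monoidal_category_axioms eo(1) em(1)]
  by (simp add: test_def)

lemma incl_coslice: "incl \<in> coslice_objects (StrMonCat U) C"
  using small small_test strict_monoidal_functor_functor_of[OF incl_map]
  by (simp add: coslice_objects_def incl_def)

context
  fixes \<alpha>
  assumes \<alpha>: "\<alpha> \<in> carrier (isotropy_group (StrMonCat U) C)"
begin

text \<open>The component of \<alpha> at \<open>incl\<close>, carried back from the copy
  \<open>test\<close> to \<open>E\<close>.\<close>

definition "obj_comp x = deo (OMap (\<alpha> incl) (eo x))"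
definition "arr_comp f = dem (AMap (\<alpha> incl) (em f))"

lemma automorphism_incl: "\<alpha> incl \<in> automorphisms (StrMonCat U) test"
proof -
  have "\<alpha> incl \<in> automorphisms (StrMonCat U) (Cod (StrMonCat U) incl)"
    using \<alpha> incl_coslice unfolding isotropy_group_def by (simp add: PiE_iff)
  then show ?thesis
    by (simp add: incl_def)
qed

lemma Src_\<alpha>_incl: "Src (\<alpha> incl) = test"
  using automorphism_incl by (simp add: automorphisms_def)

lemma \<alpha>_incl: "monoidal_map test test (OMap (\<alpha> incl)) (AMap (\<alpha> incl))"
  using automorphism_incl monoidal_map_functor[of "\<alpha> incl"] by (simp add: automorphisms_def)

lemma monoidal_map_comp_E: "monoidal_map E E obj_comp arr_comp"
  unfolding obj_comp_def[abs_def] arr_comp_def[abs_def]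
  by (rule monoidal_map_comp[OF enc monoidal_map_comp[OF \<alpha>_incl dec]])

lemma eo_obj_comp: "x \<in> Obj E \<Longrightarrow> eo (obj_comp x) = OMap (\<alpha> incl) (eo x)"
  using monoidal_map.fo_in[OF \<alpha>_incl, of "eo x"]
  by (simp add: obj_comp_def test_Obj f_inv_into_f)

text \<open>The automorphism \<open>\<alpha> incl\<close> has a left inverse, and \<open>eo\<close>
  is injective.\<close>

lemma inj_on_obj_comp: "inj_on obj_comp (Obj E)"
proof -
  obtain G where G: "Comp (StrMonCat U) G (\<alpha> incl) = Ide (StrMonCat U) test"
    using automorphism_incl by (auto simp: automorphisms_def)
  have "OMap G (eo (obj_comp x)) = eo x" if "x \<in> Obj E" for x
    using fun_cong[OF arg_cong[OF G, of OMap], of "eo x"] that Src_\<alpha>_incl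
    by (simp add: StrMonCat_def compose_def test_Obj eo_obj_comp)
  then have "inj_on (\<lambda>x. OMap G (eo (obj_comp x))) (Obj E)"
    using eo(1) by (simp add: inj_on_def)
  then show ?thesis
    by (auto simp: inj_on_def)
qed

text \<open>A map out of \<open>E\<close> that extends \<open>m\<close> is, after decoding, a
  coslice arrow from \<open>incl\<close> to \<open>m\<close>. Hence the component at
  \<open>incl\<close> determines \<open>\<alpha> m\<close> on the image of every such
  extension.\<close>

lemma naturality:
  assumes m: "m \<in> coslice_objects (StrMonCat U) C"
    and n: "monoidal_map E (Tgt m) no na"
    and ext: "\<And>x. x \<in> Obj C \<Longrightarrow> no (io x) = OMap m x" "\<And>f. f \<in> Arr C \<Longrightarrow> na (ia f) = AMap m f"
  shows "x \<in> Obj E \<Longrightarrow> OMap (\<alpha> m) (no x) = no (obj_comp x)"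
    and "f \<in> Arr E \<Longrightarrow> AMap (\<alpha> m) (na f) = na (arr_comp f)"
proof -
  let ?n = "functor_of test (Tgt m) (\<lambda>x. no (deo x)) (\<lambda>f. na (dem f))"
  have m': "strict_monoidal_functor m" "Src m = C" "small_strict_monoidal_category U (Tgt m)"
    using m by (auto simp: coslice_objects_def)
  have nn: "monoidal_map test (Tgt m) (\<lambda>x. no (deo x)) (\<lambda>f. na (dem f))"
    by (rule monoidal_map_comp[OF dec n])
  then have n_in: "?n \<in> Arr (StrMonCat U)"
    using m' small_test by (simp add: strict_monoidal_functor_functor_of)
  \<comment> \<open>Encoding and decoding cancel, and the extension hypothesis then makes the
    composite equal to \<open>m\<close>.\<close>
  have "Comp (StrMonCat U) ?n incl
      = functor_of C (Tgt m) (\<lambda>x. no (deo (eo (io x)))) (\<lambda>f. na (dem (em (ia f))))"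
    unfolding incl_def by (rule Comp_functor_of[OF incl_map])
  also have "\<dots> = functor_of C (Tgt m) (OMap m) (AMap m)"
    by (rule functor_of_cong)
      (simp_all add: inv_into_f_f[OF eo(1)] inv_into_f_f[OF em(1)] I.fo_in I.fa_in ext)
  also have "\<dots> = m"
    using functor_eq_functor_of[OF m'(1)] m'(2) by simp
  finally have m_eq: "Comp (StrMonCat U) ?n incl = m" .
  have "Comp (StrMonCat U) (\<alpha> (Comp (StrMonCat U) ?n incl)) ?n = Comp (StrMonCat U) ?n (\<alpha> incl)"
    using \<alpha> incl_coslice n_in unfolding isotropy_group_def
    by (simp only: partial_object.simps mem_Collect_eq) (simp add: incl_def)
  then have "Comp (StrMonCat U) (\<alpha> m) ?n = Comp (StrMonCat U) ?n (\<alpha> incl)"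
    unfolding m_eq .
  then have O: "compose (Obj test) (OMap (\<alpha> m)) (OMap ?n) = compose (Obj test) (OMap ?n) (OMap (\<alpha> incl))"
    and A: "compose (Arr test) (AMap (\<alpha> m)) (AMap ?n) = compose (Arr test) (AMap ?n) (AMap (\<alpha> incl))"
    using Src_\<alpha>_incl by (simp_all add: StrMonCat_def)
  show "OMap (\<alpha> m) (no x) = no (obj_comp x)" if "x \<in> Obj E" for x
    using fun_cong[OF O, of "eo x"] that monoidal_map.fo_in[OF \<alpha>_incl, of "eo x"]
    by (simp add: compose_def test_Obj inv_into_f_f[OF eo(1)] obj_comp_def)
  show "AMap (\<alpha> m) (na f) = na (arr_comp f)" if "f \<in> Arr E" for f
    using fun_cong[OF A, of "em f"] that monoidal_map.fa_in[OF \<alpha>_incl, of "em f"]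
    by (simp add: compose_def test_Obj inv_into_f_f[OF em(1)] arr_comp_def)
qed

text \<open>An endomap of \<open>E\<close> fixing the image of \<open>C\<close> becomes, once
  encoded, an extension of \<open>incl\<close> itself, so naturality applies with \<open>m\<close>
  taken to be \<open>incl\<close>.\<close>

lemma naturality_E:
  assumes n: "monoidal_map E E no na"
    and ext: "\<And>x. x \<in> Obj C \<Longrightarrow> no (io x) = io x" "\<And>f. f \<in> Arr C \<Longrightarrow> na (ia f) = ia f"
  shows "x \<in> Obj E \<Longrightarrow> obj_comp (no x) = no (obj_comp x)"
    and "f \<in> Arr E \<Longrightarrow> arr_comp (na f) = na (arr_comp f)"
proof -
  have n': "monoidal_map E (Tgt incl) (\<lambda>x. eo (no x)) (\<lambda>f. em (na f))"
    using monoidal_map_comp[OF n enc] by (simp add: incl_def)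
  note nat = naturality[OF incl_coslice n']
  show "obj_comp (no x) = no (obj_comp x)" if "x \<in> Obj E" for x
    using nat(1)[of x] that monoidal_map.fo_in[OF n] monoidal_map.fo_in[OF monoidal_map_comp_E]
    by (simp add: incl_def ext obj_comp_def[of "no x"] inv_into_f_f[OF eo(1)])
  show "arr_comp (na f) = na (arr_comp f)" if "f \<in> Arr E" for f
    using nat(2)[of f] that monoidal_map.fa_in[OF n] monoidal_map.fa_in[OF monoidal_map_comp_E]
    by (simp add: incl_def ext arr_comp_def[of "na f"] inv_into_f_f[OF em(1)])
qed

end

end

section \<open>Conjugation functors\<close>

text \<open>The right-nested bracketing agrees with the value of \<open>weval\<close> at a word
  \<open>Step a k (End b)\<close>.\<close>

definition conj_functor :: "('o, 'm) moncat \<Rightarrow> 'o \<Rightarrow> 'o \<Rightarrow> ('o, 'm) smfunctor" where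
  "conj_functor D c c' = functor_of D D (\<lambda>x. TensO D c (TensO D x c'))
     (\<lambda>f. TensA D (Ide D c) (TensA D f (Ide D c')))"

lemma conj_functor_simps [simp]:
  "Src (conj_functor D c c') = D"
  "Tgt (conj_functor D c c') = D"
  by (simp_all add: conj_functor_def)

definition inverse_objects :: "('o, 'm, 'z) moncat_scheme \<Rightarrow> 'o \<Rightarrow> 'o \<Rightarrow> bool" where
  "inverse_objects D c c' \<longleftrightarrow>
     c \<in> Obj D \<and> c' \<in> Obj D \<and> TensO D c c' = UnitO D \<and> TensO D c' c = UnitO D"

lemma inverse_objects_map:
  assumes "monoidal_map C D fo fa" "inverse_objects C a b"
  shows "inverse_objects D (fo a) (fo b)"
  using assms monoidal_map.fo_in[OF assms(1)] monoidal_map.fo_UnitO[OF assms(1)]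
  by (simp add: inverse_objects_def monoidal_map.fo_TensO[OF assms(1), symmetric])

lemma inverse_objects_sym: "inverse_objects D c c' \<Longrightarrow> inverse_objects D c' c"
  by (simp add: inverse_objects_def)

text \<open>In a product of two conjugates the inner \<open>c'\<close> and \<open>c\<close> cancel.
  Composition is preserved by interchange, since the identities at both ends are idempotent.\<close>

lemma monoidal_map_conj:
  fixes D :: "('o, 'm) moncat"
  assumes "strict_monoidal_category D" "inverse_objects D c c'"
  shows "monoidal_map D D (\<lambda>x. TensO D c (TensO D x c'))
     (\<lambda>f. TensA D (Ide D c) (TensA D f (Ide D c')))"
proof -
  interpret D: strict_monoidal_category D by fact
  have c: "c \<in> Obj D" "c' \<in> Obj D" "TensO D c c' = UnitO D" "TensO D c' c = UnitO D"
    using assms(2) by (auto simp: inverse_objects_def)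
  have ide: "Comp D (Ide D x) (Ide D x) = Ide D x" if "x \<in> Obj D" for x
    using D.Comp_Ide_left[of "Ide D x"] that by (simp add: D.Ide_in D.Cod_Ide)
  have o: "TensO D c' (TensO D c x) = x" if "x \<in> Obj D" for x
    using that c by (simp add: D.TensO_assoc[symmetric] D.TensO_UnitO_left)
  have a: "TensA D (Ide D c') (TensA D (Ide D c) f) = f" if "f \<in> Arr D" for f
    using that c by (simp add: D.TensA_assoc[symmetric] D.TensA_Ide D.TensA_UnitO_left D.Ide_in)
  show ?thesis
  proof (unfold_locales, goal_cases)
    case (6 f g)
    then have "Comp D (TensA D g (Ide D c')) (TensA D f (Ide D c'))
        = TensA D (Comp D g f) (Ide D c')"
      using c D.TensA_Comp[of f g "Ide D c'" "Ide D c'"] by (simp add: D.Ide_in D.Dom_Ide D.Cod_Ide ide)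
    with 6 show ?case
      using c D.TensA_Comp[of "Ide D c" "Ide D c" "TensA D f (Ide D c')" "TensA D g (Ide D c')"]
      by (simp add: D.Ide_in D.Dom_Ide D.Cod_Ide ide D.TensA_in D.Dom_TensA D.Cod_TensA)
  next
    case 7
    then show ?case
      using c by (simp add: D.TensO_UnitO_left)
  next
    case (8 x y)
    then show ?case
      using c by (simp add: D.TensO_assoc D.TensO_in o)
  next
    case (9 f g)
    then show ?case
      using c by (simp add: D.TensA_assoc D.TensA_in D.Ide_in a)
  qed (use c in \<open>auto simp: D.TensO_in D.TensA_in D.Ide_in D.Dom_TensA D.Cod_TensA D.Dom_Ide D.Cod_Ide
        D.Dom_in D.Cod_in D.TensA_Ide\<close>)
qed

lemma Comp_conj_functor:
  fixes D :: "('o, 'o) moncat"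
  assumes "strict_monoidal_category D" "inverse_objects D c c'" "inverse_objects D e e'"
  shows "Comp (StrMonCat U) (conj_functor D c c') (conj_functor D e e')
    = conj_functor D (TensO D c e) (TensO D e' c')"
proof -
  interpret D: strict_monoidal_category D by fact
  have *: "c \<in> Obj D" "c' \<in> Obj D" "e \<in> Obj D" "e' \<in> Obj D"
    using assms by (auto simp: inverse_objects_def)
  show ?thesis
    unfolding conj_functor_def Comp_functor_of[OF monoidal_map_conj[OF assms(1,3)]]
    by (rule functor_of_cong)
      (use * in \<open>auto simp: D.TensO_assoc D.TensO_in D.TensA_assoc D.TensA_in D.Ide_in
        D.TensA_Ide[symmetric]\<close>)
qed

lemma conj_functor_unit:
  fixes D :: "('o, 'o) moncat"
  assumes "strict_monoidal_category D"
  shows "conj_functor D (UnitO D) (UnitO D) = Ide (StrMonCat U) D"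
proof -
  interpret D: strict_monoidal_category D by fact
  show ?thesis
    unfolding conj_functor_def StrMonCat_simps
    by (rule functor_of_cong)
      (simp_all add: D.TensO_UnitO_left D.TensO_UnitO_right D.TensA_UnitO_left D.TensA_UnitO_right)
qed

lemma conj_functor_Arr:
  assumes "small_strict_monoidal_category U D" "inverse_objects D c c'"
  shows "conj_functor D c c' \<in> Arr (StrMonCat U)"
  using assms strict_monoidal_functor_functor_of[OF monoidal_map_conj[OF _ assms(2)]]
  by (auto simp: small_strict_monoidal_category_def conj_functor_def)

lemma conj_functor_automorphism:
  assumes "small_strict_monoidal_category U D" "inverse_objects D c c'"
  shows "conj_functor D c c' \<in> automorphisms (StrMonCat U) D"
proof -
  have D: "strict_monoidal_category D"
    using assms(1) by (simp add: small_strict_monoidal_category_def)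
  have "Comp (StrMonCat U) (conj_functor D c' c) (conj_functor D c c') = Ide (StrMonCat U) D"
    "Comp (StrMonCat U) (conj_functor D c c') (conj_functor D c' c) = Ide (StrMonCat U) D"
    using assms(2) D
    by (simp_all only: Comp_conj_functor inverse_objects_sym conj_functor_unit[symmetric])
      (simp_all add: inverse_objects_def)
  then show ?thesis
    using conj_functor_Arr[OF assms] conj_functor_Arr[OF assms(1) inverse_objects_sym[OF assms(2)]]
    unfolding automorphisms_def StrMonCat_simps(3,4) by auto
qed

lemma conj_functor_naturality:
  assumes "monoidal_map D E (OMap n) (AMap n)" "n = functor_of D E (OMap n) (AMap n)"
    and "inverse_objects D c c'"
  shows "Comp (StrMonCat U) (conj_functor E (OMap n c) (OMap n c')) n
    = Comp (StrMonCat U) n (conj_functor D c c')"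
proof -
  interpret n: monoidal_map D E "OMap n" "AMap n" by fact
  have c: "c \<in> Obj D" "c' \<in> Obj D"
    using assms(3) by (auto simp: inverse_objects_def)
  have "Comp (StrMonCat U) (conj_functor E (OMap n c) (OMap n c')) (functor_of D E (OMap n) (AMap n))
    = Comp (StrMonCat U) (functor_of D E (OMap n) (AMap n)) (conj_functor D c c')"
    unfolding conj_functor_def Comp_functor_of[OF assms(1)]
      Comp_functor_of[OF monoidal_map_conj[OF n.S.strict_monoidal_category_axioms assms(3)]]
    by (rule functor_of_cong)
      (use c in \<open>simp_all add: n.fo_TensO n.fa_TensA n.fa_Ide n.S.TensO_in n.S.TensA_in n.S.Ide_in\<close>)
  then show ?thesis
    using assms(2) by simp
qed

lemma conj_family_in_isotropy:
  assumes "inverse_objects C a b"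
  shows "(\<lambda>m \<in> coslice_objects (StrMonCat U) C. conj_functor (Tgt m) (OMap m a) (OMap m b))
    \<in> carrier (isotropy_group (StrMonCat U) C)"
proof -
  let ?S = "coslice_objects (StrMonCat U) C"
  have m: "strict_monoidal_functor m" "Src m = C" "small_strict_monoidal_category U (Tgt m)"
      "inverse_objects (Tgt m) (OMap m a) (OMap m b)" if "m \<in> ?S" for m
    using that assms inverse_objects_map[OF monoidal_map_functor, of m a b]
    by (auto simp: coslice_objects_def)
  have "Comp (StrMonCat U) (conj_functor (Tgt n) (OMap n (OMap m a)) (OMap n (OMap m b))) n
      = Comp (StrMonCat U) n (conj_functor (Tgt m) (OMap m a) (OMap m b))"
    if "m \<in> ?S" "n \<in> Arr (StrMonCat U)" "Src n = Tgt m" for m n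
    by (rule conj_functor_naturality[where D = "Tgt m"])
      (use that m(4)[OF that(1)] monoidal_map_functor[of n] functor_eq_functor_of[of n] in auto)
  moreover have "conj_functor (Tgt m) (OMap m a) (OMap m b) \<in> automorphisms (StrMonCat U) (Tgt m)"
    if "m \<in> ?S" for m
    by (rule conj_functor_automorphism) (use m[OF that] in auto)
  \<comment> \<open>The object map of a composite is restricted to \<open>Obj C\<close>, so this
    applies to \<open>a\<close> and \<open>b\<close> only as members of that set.\<close>
  moreover have "OMap (Comp (StrMonCat U) n m) x = OMap n (OMap m x)" "Tgt (Comp (StrMonCat U) n m) = Tgt n"
      "Comp (StrMonCat U) n m \<in> ?S"
    if "m \<in> ?S" "n \<in> Arr (StrMonCat U)" "Src n = Tgt m" "x \<in> Obj C" for m n x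
    using that category.Comp_in[OF category_StrMonCat, of m U n] category.Dom_Comp[OF category_StrMonCat, of m U n]
    by (auto simp: coslice_objects_def) (simp_all add: StrMonCat_def compose_def)
  moreover have "a \<in> Obj C" "b \<in> Obj C"
    using assms by (auto simp: inverse_objects_def)
  ultimately show ?thesis
    unfolding isotropy_group_def by (simp del: StrMonCat_simps(2) add: PiE_iff)
qed

section \<open>Every isotropy element is a conjugation\<close>

text \<open>\<open>w\<close> stands for the value at a free object \<open>x\<close>, where \<open>x\<close> and \<open>y\<close> are the letters
  \<open>False\<close> and \<open>True\<close>.  Substituting \<open>x y\<close> for \<open>x\<close> in a word with at least two letters puts the
  adjacent letters \<open>x y\<close> at the front, whereas the product of the two substitution instances starts
  with two letters \<open>x\<close>.\<close>

lemma (in strict_monoidal_category) multiplicative_word_linear: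
  fixes w :: "('o, bool) word"
  defines "s \<equiv> \<lambda>e :: ('o, bool) word. weval (wapp (TensO C)) End (\<lambda>_ :: bool. e)"
    and "x \<equiv> Step (UnitO C) False (End (UnitO C))" and "y \<equiv> Step (UnitO C) True (End (UnitO C))"
  assumes w: "w \<in> words (Obj C) UNIV"
    and unit: "s (End (UnitO C)) w = End (UnitO C)"
    and mult: "s (wapp (TensO C) x y) w = wapp (TensO C) (s x w) (s y w)"
    and inj: "s x w \<noteq> End (UnitO C)"
  shows "\<exists>a b k. w = Step a k (End b) \<and> inverse_objects C a b"
proof (cases w)
  \<comment> \<open>Without letters, the unit condition gives \<open>a = UnitO C\<close>, against
    \<open>inj\<close>.\<close>
  case (End a)
  then show ?thesis
    using unit inj by (simp add: s_def)
next
  case (Step a k v)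
  then have a: "a \<in> Obj C" and v: "v \<in> words (Obj C) UNIV"
    using w by auto
  show ?thesis
  proof (cases v)
    \<comment> \<open>With one letter, substituting the unit gives a b = I, and comparing the middle
      coefficients in \<open>mult\<close> gives b a = I.\<close>
    case (End b)
    then show ?thesis
      using Step a v unit mult
      by (auto simp: s_def x_def y_def inverse_objects_def UnitO_in TensO_in TensO_UnitO_left
          TensO_UnitO_right)
  next
    case (Step b l u)
    then show ?thesis
      using \<open>w = Step a k v\<close> a v mult
      by (auto simp: s_def x_def y_def UnitO_in TensO_in TensO_UnitO_left TensO_UnitO_right)
  qed
qed

lemma (in adjunction_data) monoidal_map_End: "monoidal_map C (adjoin C K) End End"
  by unfold_locales auto

locale arrow_test = embeddable U C "adjoin C arrow_cat" End End eo em
  for U :: "'u set set" and C :: "('u, 'u) moncat" and eo em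
begin

text \<open>The universal property in the form used below: the free arrow goes to \<open>g\<close>.
  Taking an identity for \<open>g\<close> sends both free objects to one prescribed object.\<close>

lemma monoidal_map_subst:
  assumes "monoidal_map C D mo ma" "g \<in> Arr D"
  shows "monoidal_map (adjoin C arrow_cat) D
    (weval (TensO D) mo (point_obj D g)) (weval (TensA D) ma (point_arr D g))"
proof -
  interpret M: monoidal_map C D mo ma by fact
  interpret evaluation C arrow_cat D mo ma "point_obj D g" "point_arr D g"
    by (intro evaluation.intro adjunction_data.intro I.S.strict_monoidal_category_axioms
        category_arrow_cat assms functor_map_point M.T.category_axioms)
  show ?thesis by (rule monoidal_map_eval)
qed

lemma isotropy_conjugation:
  assumes \<alpha>: "\<alpha> \<in> carrier (isotropy_group (StrMonCat U) C)"
  shows "\<exists>a b. inverse_objects C a b \<and>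
    \<alpha> = (\<lambda>m \<in> coslice_objects (StrMonCat U) C. conj_functor (Tgt m) (OMap m a) (OMap m b))"
proof -
  let ?E = "adjoin C arrow_cat"
  let ?I = "UnitO C"
  let ?i = "Ide C ?I"
  let ?x = "Step ?I False (End ?I)" and ?y = "Step ?I True (End ?I)"
  let ?f = "Step ?i (False, True) (End ?i)" and ?idx = "Step ?i (False, False) (End ?i)"
  let ?s = "\<lambda>e. weval (wapp (TensO C)) End (\<lambda>_ :: bool. e)"
  define \<beta> where "\<beta> = obj_comp \<alpha>"
  define \<gamma> where "\<gamma> = arr_comp \<alpha>"
  interpret \<beta>: monoidal_map ?E ?E \<beta> \<gamma>
    unfolding \<beta>_def \<gamma>_def by (rule monoidal_map_comp_E[OF \<alpha>])
  note [simp] = I.S.UnitO_in I.S.Ide_in I.S.TensO_UnitO_left I.S.TensO_UnitO_right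
    I.S.TensA_UnitO_left I.S.TensA_UnitO_right I.S.Dom_Ide I.S.Cod_Ide
  have xE: "?x \<in> Obj ?E" "?y \<in> Obj ?E" and fE: "?f \<in> Arr ?E" "?idx \<in> Arr ?E"
    by auto
  have unitE: "wapp (TensO C) (End ?I) (wapp (TensO C) e (End ?I)) = e" if "e \<in> Obj ?E" for e
    using that I.T.TensO_UnitO_left[OF that] I.T.TensO_UnitO_right[OF that] by simp
  have s: "weval (TensO ?E) End (point_obj ?E (Ide ?E e)) = ?s e" if "e \<in> Obj ?E" for e
  proof -
    have "point_obj ?E (Ide ?E e) = (\<lambda>_. e)"
      using I.T.Dom_Ide[OF that] I.T.Cod_Ide[OF that] by (simp add: point_obj_def fun_eq_iff)
    then show ?thesis by simp
  qed
  \<comment> \<open>Naturality for the endomap that sends both letters to \<open>e\<close>; it maps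
    \<open>?x\<close> to \<open>e\<close>, so the value at \<open>?x\<close> determines \<beta>
    everywhere.\<close>
  have sub: "\<beta> e = ?s e (\<beta> ?x)" if e: "e \<in> Obj ?E" for e
    using naturality_E(1)[OF \<alpha> monoidal_map_subst[OF I.monoidal_map_axioms I.T.Ide_in[OF e]] _ _ xE(1)]
    unfolding s[OF e] by (simp add: \<beta>_def unitE[OF e])
  obtain a b k where w: "\<beta> ?x = Step a k (End b)" and ab: "inverse_objects C a b"
  proof -
    have "\<beta> ?x \<noteq> End ?I"
    proof
      assume "\<beta> ?x = End ?I"
      then have "\<beta> ?x = \<beta> (End ?I)"
        using \<beta>.fo_UnitO by simp
      then show False
        using inj_on_eq_iff[OF inj_on_obj_comp[OF \<alpha>], of ?x "End ?I"] by (simp add: \<beta>_def)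
    qed
    moreover have "\<beta> (wapp (TensO C) ?x ?y) = wapp (TensO C) (\<beta> ?x) (\<beta> ?y)"
      using \<beta>.fo_TensO[OF xE] by simp
    moreover have "wapp (TensO C) ?x ?y \<in> Obj ?E"
      using I.T.TensO_in[OF xE] by simp
    moreover have "\<beta> (End ?I) = End ?I"
      using \<beta>.fo_UnitO by simp
    ultimately have "\<exists>a b k. \<beta> ?x = Step a k (End b) \<and> inverse_objects C a b"
      using sub[of "wapp (TensO C) ?x ?y"] sub[of ?x] sub[of ?y] sub[of "End ?I"] xE \<beta>.fo_in[OF xE(1)]
      by (intro I.S.multiplicative_word_linear) auto
    then show thesis using that by blast
  qed
  have abC: "a \<in> Obj C" "b \<in> Obj C"
    using ab by (auto simp: inverse_objects_def)
  \<comment> \<open>Substituting \<open>?x\<close> into its own value leaves that value fixed, so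
    the letter \<open>k\<close> is \<open>False\<close>; substituting \<open>?y\<close> gives the
    second value.\<close>
  have \<beta>x: "\<beta> ?x = Step a False (End b)" and \<beta>y: "\<beta> ?y = Step a True (End b)"
    using sub[OF xE(1)] sub[OF xE(2)] abC unfolding w by simp_all
  have \<gamma>f: "\<gamma> ?f \<in> words (Arr C) (Arr arrow_cat)" "map_word (Dom C) fst (\<gamma> ?f) = Step a False (End b)"
      "map_word (Cod C) snd (\<gamma> ?f) = Step a True (End b)"
    using \<beta>.fa_in[OF fE(1)] \<beta>.Dom_fa[OF fE(1)] \<beta>.Cod_fa[OF fE(1)] \<beta>x \<beta>y by simp_all
  \<comment> \<open>Domain and codomain fix the shape of \<open>\<gamma> ?f\<close> and its letter;
    only the two coefficients remain open.\<close>
  then obtain u v where uv: "\<gamma> ?f = Step u (False, True) (End v)" "u \<in> Arr C" "v \<in> Arr C"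
    by (auto simp: map_word_eq_Step map_word_eq_End)
  have "\<gamma> ?idx = Step (Ide C a) (False, False) (End (Ide C b))"
    using \<beta>.fa_Ide[OF xE(1)] \<beta>x by simp
  \<comment> \<open>Collapsing the free arrow to an identity changes the letter but keeps
    \<open>u\<close> and \<open>v\<close>, so they can be compared with the coefficients of an
    identity.\<close>
  moreover have "\<gamma> ?idx = Step u (False, False) (End v)"
  proof -
    have "?idx = Ide ?E ?x" by simp
    then have "?idx \<in> Arr ?E" by simp
    from naturality_E(2)[OF \<alpha> monoidal_map_subst[OF I.monoidal_map_axioms this] _ _ fE(1)] uv
    show ?thesis
      by (simp add: point_arr_def \<gamma>_def)
  qed
  ultimately have \<gamma>f': "\<gamma> ?f = Step (Ide C a) (False, True) (End (Ide C b))"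
    using uv by simp
  have "\<alpha> m = conj_functor (Tgt m) (OMap m a) (OMap m b)" if m: "m \<in> coslice_objects (StrMonCat U) C" for m
  proof -
    let ?D = "Tgt m"
    have m': "strict_monoidal_functor m" "Src m = C"
      using m by (auto simp: coslice_objects_def)
    interpret m: monoidal_map C ?D "OMap m" "AMap m"
      using monoidal_map_functor[OF m'(1)] m'(2) by simp
    have "\<alpha> m \<in> automorphisms (StrMonCat U) (Cod (StrMonCat U) m)"
      using \<alpha> m unfolding isotropy_group_def by (simp add: PiE_iff)
    then have \<alpha>m: "strict_monoidal_functor (\<alpha> m)" "Src (\<alpha> m) = ?D" "Tgt (\<alpha> m) = ?D"
      by (simp_all add: automorphisms_def)
    \<comment> \<open>Each \<open>g\<close> is the image of the free arrow under an extension of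
      \<open>m\<close>, so \<open>\<gamma> ?f\<close> yields the value at \<open>g\<close>. Objects
      are treated below through their identities.\<close>
    have arr: "AMap (\<alpha> m) g = TensA ?D (Ide ?D (OMap m a)) (TensA ?D g (Ide ?D (OMap m b)))"
      if g: "g \<in> Arr ?D" for g
      using naturality(2)[OF \<alpha> m monoidal_map_subst[OF m.monoidal_map_axioms g] _ _ fE(1)]
        \<gamma>f' g abC
      by (simp add: point_arr_def \<gamma>_def m.fa_Ide m.fo_UnitO m.T.TensA_UnitO_left m.T.TensA_UnitO_right)
    have obj: "OMap (\<alpha> m) d = TensO ?D (OMap m a) (TensO ?D d (OMap m b))" if d: "d \<in> Obj ?D" for d
      using naturality(1)[OF \<alpha> m monoidal_map_subst[OF m.monoidal_map_axioms m.T.Ide_in[OF d]] _ _ xE(1)]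
        \<beta>x d abC
      by (simp add: point_obj_def \<beta>_def m.T.Dom_Ide m.fo_UnitO m.T.TensO_UnitO_left m.T.TensO_UnitO_right)
    have "\<alpha> m = functor_of ?D ?D (OMap (\<alpha> m)) (AMap (\<alpha> m))"
      using functor_eq_functor_of[OF \<alpha>m(1)] \<alpha>m(2,3) by simp
    also have "\<dots> = conj_functor ?D (OMap m a) (OMap m b)"
      unfolding conj_functor_def by (rule functor_of_cong) (simp_all add: arr obj)
    finally show ?thesis .
  qed
  moreover have "\<alpha> \<in> extensional (coslice_objects (StrMonCat U) C)"
    using \<alpha> by (simp add: isotropy_group_def PiE_iff)
  ultimately have "\<alpha> = (\<lambda>m \<in> coslice_objects (StrMonCat U) C. conj_functor (Tgt m) (OMap m a) (OMap m b))"
    by (intro extensionalityI[of \<alpha> "coslice_objects (StrMonCat U) C"]) simp_all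
  with ab show ?thesis by blast
qed

text \<open>At the free object x the conjugation takes the value a x b, a normal form from which
  \<open>a\<close> can be read off.\<close>

lemma conj_functor_incl_inj:
  assumes "inverse_objects C a b" "inverse_objects C a' b'"
    and "conj_functor test (OMap incl a) (OMap incl b) = conj_functor test (OMap incl a') (OMap incl b')"
  shows "a = a'"
proof -
  let ?E = "adjoin C arrow_cat"
  let ?x = "Step (UnitO C) False (End (UnitO C))"
  interpret enc: monoidal_map ?E test eo em by (rule enc)
  have ab: "a \<in> Obj C" "b \<in> Obj C" "a' \<in> Obj C" "b' \<in> Obj C"
    using assms by (auto simp: inverse_objects_def)
  have x: "?x \<in> Obj ?E" by (simp add: I.S.UnitO_in)
  have conj: "OMap (conj_functor test (OMap incl c) (OMap incl d)) (eo ?x) = eo (Step c False (End d))"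
    if "c \<in> Obj C" "d \<in> Obj C" for c d
  proof -
    have "OMap (conj_functor test (OMap incl c) (OMap incl d)) (eo ?x)
        = TensO test (eo (End c)) (TensO test (eo ?x) (eo (End d)))"
      using that enc.fo_in[OF x] by (simp add: conj_functor_def incl_def)
    also have "\<dots> = eo (TensO ?E (End c) (TensO ?E ?x (End d)))"
      using that x I.T.TensO_in[OF x, of "End d"] enc.fo_TensO[OF x, of "End d"]
        enc.fo_TensO[of "End c" "TensO ?E ?x (End d)"] by simp
    also have "\<dots> = eo (Step c False (End d))"
      using that by (simp add: I.S.TensO_UnitO_left I.S.TensO_UnitO_right)
    finally show ?thesis .
  qed
  have "eo (Step a False (End b)) = eo (Step a' False (End b'))"
    using assms(3) conj[of a b] conj[of a' b'] ab by simp
  then show ?thesis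
    using ab inj_on_eq_iff[OF eo(1), of "Step a False (End b)" "Step a' False (End b')"] by simp
qed

end

section \<open>The isomorphism with the Picard group\<close>

lemma ex_arrow_test:
  assumes "universe U" "small_strict_monoidal_category U C"
  shows "\<exists>eo em. arrow_test U C eo em"
proof -
  have C: "strict_monoidal_category C" "Obj C \<in> U" "Arr C \<in> U"
    using assms(2) by (auto simp: small_strict_monoidal_category_def)
  interpret adjunction_data C arrow_cat
    by (intro adjunction_data.intro C category_arrow_cat)
  obtain eo where eo: "inj_on eo (words (Obj C) (Obj arrow_cat))" "eo ` words (Obj C) (Obj arrow_cat) \<in> U"
    using universe_words[OF assms(1) C(2), of "Obj arrow_cat"] by auto
  obtain em where em: "inj_on em (words (Arr C) (Arr arrow_cat))" "em ` words (Arr C) (Arr arrow_cat) \<in> U"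
    using universe_words[OF assms(1) C(3) finite[of "Arr arrow_cat"]] by blast
  have "arrow_test U C eo em"
    by (intro arrow_test.intro embeddable.intro embeddable_axioms.intro monoidal_map_End assms(2))
      (use eo em in simp_all)
  then show ?thesis by blast
qed

lemma (in strict_monoidal_category) Picard_group_simps:
  "carrier (Picard_group C) = {a. \<exists>b. inverse_objects C a b}"
  "x \<otimes>\<^bsub>Picard_group C\<^esub> y = TensO C x y"
  by (auto simp: Picard_group_def units_of_def Units_def object_monoid_def inverse_objects_def)

theorem theorem8:
  fixes U :: "'u set set" and C :: "('u, 'u) moncat"
  assumes "universe U"
    and "small_strict_monoidal_category U C"
  shows "isotropy_group (StrMonCat U) C \<cong> Picard_group C"
proof -
  let ?S = "coslice_objects (StrMonCat U) C"
  let ?Z = "isotropy_group (StrMonCat U) C"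
  obtain eo em where "arrow_test U C eo em"
    using ex_arrow_test[OF assms] by blast
  then interpret arrow_test U C eo em .
  have P: "group (Picard_group C)"
    by (rule group_Picard_group) (rule I.S.strict_monoidal_category_axioms)
  \<comment> \<open>An inverse is chosen only to make \<phi> a function of \<open>a\<close>; by
    uniqueness of inverses, \<open>\<phi>_eq\<close> allows any inverse in its place.\<close>
  define inv' where "inv' a = (SOME b. inverse_objects C a b)" for a
  define \<phi> where
    "\<phi> a = (\<lambda>m \<in> ?S. conj_functor (Tgt m) (OMap m a) (OMap m (inv' a)))" for a
  have inv': "inverse_objects C a (inv' a)" if "inverse_objects C a b" for a b
    using that unfolding inv'_def by (rule someI)
  have uniq: "b = b'" if "inverse_objects C a b" "inverse_objects C a b'" for a b b'
    using monoid.inv_unique[OF monoid_object_monoid[OF I.S.strict_monoidal_category_axioms], of b a b'] that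
    by (simp add: object_monoid_def inverse_objects_def)
  have \<phi>_eq: "\<phi> a = (\<lambda>m \<in> ?S. conj_functor (Tgt m) (OMap m a) (OMap m b))" if "inverse_objects C a b" for a b
    using uniq[OF inv'[OF that] that] by (simp add: \<phi>_def)
  have mult: "inverse_objects C (TensO C a b) (TensO C b' a')"
    if "inverse_objects C a a'" "inverse_objects C b b'" for a a' b b'
  proof -
    \<comment> \<open>Stated for arbitrary pairs because it is used twice, the second time with the
      objects and their inverses exchanged.\<close>
    have *: "TensO C (TensO C c d) (TensO C d' c') = UnitO C"
      if "inverse_objects C c c'" "inverse_objects C d d'" for c d c' d'
    proof -
      have "TensO C d (TensO C d' c') = c'"
        using that by (simp add: inverse_objects_def I.S.TensO_assoc[symmetric] I.S.TensO_UnitO_left)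
      then show ?thesis
        using that by (simp add: inverse_objects_def I.S.TensO_assoc I.S.TensO_in)
    qed
    show ?thesis
      using that *[OF that] *[OF that(2,1)[THEN inverse_objects_sym]]
      by (simp add: inverse_objects_def I.S.TensO_in)
  qed
  have "\<phi> \<in> iso (Picard_group C) ?Z"
  proof (rule isoI)
    show "\<phi> \<in> hom (Picard_group C) ?Z"
    proof (rule homI)
      show "\<phi> a \<in> carrier ?Z" if "a \<in> carrier (Picard_group C)" for a
        using that by (auto simp: I.S.Picard_group_simps \<phi>_eq conj_family_in_isotropy)
      show "\<phi> (a \<otimes>\<^bsub>Picard_group C\<^esub> b) = \<phi> a \<otimes>\<^bsub>?Z\<^esub> \<phi> b"
        if ab: "a \<in> carrier (Picard_group C)" "b \<in> carrier (Picard_group C)" for a b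
      proof -
        obtain a' b' where inv: "inverse_objects C a a'" "inverse_objects C b b'"
          using ab unfolding I.S.Picard_group_simps by blast
        have "conj_functor (Tgt m) (OMap m (TensO C a b)) (OMap m (TensO C b' a'))
            = Comp (StrMonCat U) (conj_functor (Tgt m) (OMap m a) (OMap m a'))
                (conj_functor (Tgt m) (OMap m b) (OMap m b'))" if "m \<in> ?S" for m
        proof -
          interpret m: monoidal_map C "Tgt m" "OMap m" "AMap m"
            using that monoidal_map_functor[of m] by (auto simp: coslice_objects_def)
          show ?thesis
            using inv inverse_objects_map[OF m.monoidal_map_axioms]
            by (simp add: Comp_conj_functor m.T.strict_monoidal_category_axioms)
              (simp add: inverse_objects_def m.fo_TensO)
        qed
        then show ?thesis
          unfolding I.S.Picard_group_simps \<phi>_eq[OF mult[OF inv]] \<phi>_eq[OF inv(1)] \<phi>_eq[OF inv(2)]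
          by (auto simp: isotropy_group_def intro!: restrict_ext)
      qed
    qed
    show "bij_betw \<phi> (carrier (Picard_group C)) (carrier ?Z)"
    proof (rule bij_betw_imageI)
      show "inj_on \<phi> (carrier (Picard_group C))"
      proof (rule inj_onI)
        fix a a'
        assume "a \<in> carrier (Picard_group C)" "a' \<in> carrier (Picard_group C)" and eq: "\<phi> a = \<phi> a'"
        then obtain b b' where inv: "inverse_objects C a b" "inverse_objects C a' b'"
          unfolding I.S.Picard_group_simps by blast
        have Tgt: "Tgt incl = test" by (simp add: incl_def)
        show "a = a'"
          \<comment> \<open>Families are compared at \<open>incl\<close>, where conjugations by
            different objects differ.\<close>
          using fun_cong[OF eq, of incl] incl_coslice
          by (intro conj_functor_incl_inj[OF inv]) (simp add: \<phi>_eq[OF inv(1)] \<phi>_eq[OF inv(2)] Tgt)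
      qed
      show "\<phi> ` carrier (Picard_group C) = carrier ?Z"
      proof
        show "\<phi> ` carrier (Picard_group C) \<subseteq> carrier ?Z"
          by (auto simp: I.S.Picard_group_simps \<phi>_eq conj_family_in_isotropy)
        show "carrier ?Z \<subseteq> \<phi> ` carrier (Picard_group C)"
        proof
          fix \<alpha> assume "\<alpha> \<in> carrier ?Z"
          from isotropy_conjugation[OF this] obtain a b where "inverse_objects C a b" "\<alpha> = \<phi> a"
            using \<phi>_eq by metis
          then show "\<alpha> \<in> \<phi> ` carrier (Picard_group C)"
            by (auto simp: I.S.Picard_group_simps)
        qed
      qed
    qed
  qed
  then show ?thesis
    \<comment> \<open>\<phi> starts at the Picard group, so the isomorphism has to be
      reversed.\<close>
    by (intro group.iso_sym[OF P]) (auto simp: is_iso_def)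
qed

end
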